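(* Let $\mathcal U$ and $\mathcal V$ be universal Martin-Löf tests. Then $\mathsf{RD}_{\mathcal V}\equiv_{\mathrm W}\mathsf{LAY}_{\mathcal U}$.
   Context: Cantor space $2^\omega$, Lebesgue measure $\lambda$. A Martin-Löf (ML) test is a sequence $(\mathcal V_i)_{i\in\omega}$ of open subsets of $2^\omega$ such that $\{\langle i,\sigma\rangle:[\sigma]\subseteq\mathcal V_i\}$ is c.e. and $\lambda(\mathcal V_i)\le 2^{-i}$; it is universal if $\bigcap_i\mathcal V'_i\subseteq\bigcap_i\mathcal V_i$ for every ML-test $\mathcal V'$. $\mathrm{MLR}$ is the set of Martin-Löf random sequences ($=2^\omega\setminus\bigcap_i\mathcal U_i$ for any universal $\mathcal U$); for $X\in\mathrm{MLR}$, $\mathrm{rd}_{\mathcal U}(X)=\min\{i:X\notin\mathcal U_i\}$. A representation of a set $X$ is a surjective partial map $\delta_X:\subseteq\omega^\omega\to X$. A realizer of a multi-valued partial function $f:\subseteq X\rightrightarrows Y$ is a partial $\Gamma:\subseteq\omega^\omega\to\omega^\omega$ with $\delta_Y(\Gamma(p))\in f(\delta_X(p))$ for all $p\in\mathrm{dom}(f\circ\delta_X)$. $f\le_{\mathrm W} g$ (Weihrauch reducibility) if there are Turing functionals $\Phi,\Psi$ such that $p\mapsto\Psi(\langle p,\Gamma(\Phi(p))\rangle)$ realizes $f$ for every realizer $\Gamma$ of $g$; $\equiv_{\mathrm W}$ means reducibility in both directions. $\mathrm{MLR}$ is represented by the identity on $\mathrm{MLR}\subseteq\omega^\omega$, $\omega$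 by $\chi_{\{n\}}\mapsto n$. For universal $\mathcal U$: $\mathsf{LAY}_{\mathcal U}\colon\mathrm{MLR}\rightrightarrows\omega$, $\mathsf{LAY}_{\mathcal U}(X)=\{i:X\notin\mathcal U_i\}$; $\mathsf{RD}_{\mathcal U}\colon\mathrm{MLR}\to\omega$, $\mathsf{RD}_{\mathcal U}(X)=\mathrm{rd}_{\mathcal U}(X)$. *)

theory Defs
  imports "HOL-Probability.Probability" "HOL-Library.Nat_Bijection"
begin

datatype recf = Zero | Succ | Proj nat | Comp recf "recf list" | Prec recf recf
  | Mini recf | Orac

definition arg :: "nat \<Rightarrow> nat list \<Rightarrow> nat" where
  "arg i xs = (if i < length xs then xs ! i else 0)"

inductive ev :: "(nat \<Rightarrow> nat) \<Rightarrow> recf \<Rightarrow> nat list \<Rightarrow> nat \<Rightarrow> bool" for p where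
  ev_zero: "ev p Zero xs 0"
| ev_succ: "ev p Succ xs (Suc (arg 0 xs))"
| ev_proj: "ev p (Proj i) xs (arg i xs)"
| ev_orac: "ev p Orac xs (p (arg 0 xs))"
| ev_comp: "list_all2 (\<lambda>g y. ev p g xs y) gs ys \<Longrightarrow> ev p f ys z \<Longrightarrow> ev p (Comp f gs) xs z"
| ev_prec0: "ev p f xs y \<Longrightarrow> ev p (Prec f g) (0 # xs) y"
| ev_precS: "ev p (Prec f g) (n # xs) y \<Longrightarrow> ev p g (n # y # xs) z
             \<Longrightarrow> ev p (Prec f g) (Suc n # xs) z"
| ev_mini: "ev p f (n # xs) 0 \<Longrightarrow> (\<forall>m<n. \<exists>y. 0 < y \<and> ev p f (m # xs) y)
             \<Longrightarrow> ev p (Mini f) xs n"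

definition tfun :: "recf \<Rightarrow> (nat \<Rightarrow> nat) \<Rightarrow> (nat \<Rightarrow> nat) option" where
  "tfun e p = (if \<forall>n. \<exists>y. ev p e [n] y then Some (\<lambda>n. THE y. ev p e [n] y) else None)"

definition ce :: "nat set \<Rightarrow> bool" where
  "ce A \<longleftrightarrow> (\<exists>e. \<forall>n. n \<in> A \<longleftrightarrow> (\<exists>y. ev (\<lambda>_. 0) e [n] y))"

definition bpair :: "(nat \<Rightarrow> nat) \<Rightarrow> (nat \<Rightarrow> nat) \<Rightarrow> nat \<Rightarrow> nat" where
  "bpair p q n = (if even n then p (n div 2) else q (n div 2))"

definition cyl :: "bool list \<Rightarrow> (nat \<Rightarrow> bool) set" where
  "cyl \<sigma> = {X. \<forall>i<length \<sigma>. X i = \<sigma> ! i}"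

definition cantor_open :: "(nat \<Rightarrow> bool) set \<Rightarrow> bool" where
  "cantor_open V \<longleftrightarrow> (\<forall>X\<in>V. \<exists>\<sigma>. X \<in> cyl \<sigma> \<and> cyl \<sigma> \<subseteq> V)"

definition lam :: "(nat \<Rightarrow> bool) measure" where
  "lam = (\<Pi>\<^sub>M i\<in>(UNIV::nat set). measure_pmf (bernoulli_pmf (1/2)))"

text \<open>Bijective coding of binary strings by natural numbers.\<close>
fun code_str :: "bool list \<Rightarrow> nat" where
  "code_str [] = 0"
| "code_str (b # \<sigma>) = 2 * code_str \<sigma> + (if b then 2 else 1)"

definition mltest :: "(nat \<Rightarrow> (nat \<Rightarrow> bool) set) \<Rightarrow> bool" where
  "mltest V \<longleftrightarrow> (\<forall>i. cantor_open (V i))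
     \<and> ce {prod_encode (i, code_str \<sigma>) | i \<sigma>. cyl \<sigma> \<subseteq> V i}
     \<and> (\<forall>i. emeasure lam (V i) \<le> ennreal ((1/2) ^ i))"

definition universal_mltest :: "(nat \<Rightarrow> (nat \<Rightarrow> bool) set) \<Rightarrow> bool" where
  "universal_mltest U \<longleftrightarrow> mltest U \<and> (\<forall>V. mltest V \<longrightarrow> (\<Inter>i. V i) \<subseteq> (\<Inter>i. U i))"

definition MLR :: "(nat \<Rightarrow> bool) set" where
  "MLR = {X. \<forall>V. mltest V \<longrightarrow> X \<notin> (\<Inter>i. V i)}"

text \<open>Representations are partial surjections from Baire space, given as option-valued maps.
  Partial multi-valued functions are maps to sets; the domain is where the value is nonempty.\<close>

definition rep_MLR :: "(nat \<Rightarrow> nat) \<Rightarrow> (nat \<Rightarrow> bool) option" where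
  "rep_MLR p = (if \<exists>X\<in>MLR. p = (\<lambda>n. of_bool (X n)) then Some (\<lambda>n. p n = 1) else None)"

definition rep_nat :: "(nat \<Rightarrow> nat) \<Rightarrow> nat option" where
  "rep_nat p = (if \<exists>n. p = (\<lambda>i. of_bool (i = n)) then Some (THE n. p = (\<lambda>i. of_bool (i = n))) else None)"

definition realizer :: "((nat \<Rightarrow> nat) \<Rightarrow> 'a option) \<Rightarrow> ((nat \<Rightarrow> nat) \<Rightarrow> 'b option)
    \<Rightarrow> ('a \<Rightarrow> 'b set) \<Rightarrow> ((nat \<Rightarrow> nat) \<Rightarrow> (nat \<Rightarrow> nat) option) \<Rightarrow> bool" where
  "realizer dX dY f \<Gamma> \<longleftrightarrow> (\<forall>p x. dX p = Some x \<longrightarrow> f x \<noteq> {} \<longrightarrow>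
      (\<exists>q y. \<Gamma> p = Some q \<and> dY q = Some y \<and> y \<in> f x))"

definition W_le :: "((nat \<Rightarrow> nat) \<Rightarrow> 'a option) \<Rightarrow> ((nat \<Rightarrow> nat) \<Rightarrow> 'b option) \<Rightarrow> ('a \<Rightarrow> 'b set)
    \<Rightarrow> ((nat \<Rightarrow> nat) \<Rightarrow> 'c option) \<Rightarrow> ((nat \<Rightarrow> nat) \<Rightarrow> 'd option) \<Rightarrow> ('c \<Rightarrow> 'd set) \<Rightarrow> bool" where
  "W_le dX dY f dX' dY' g \<longleftrightarrow> (\<exists>e1 e2. \<forall>\<Gamma>. realizer dX' dY' g \<Gamma> \<longrightarrow>
      realizer dX dY f (\<lambda>p. case tfun e1 p of None \<Rightarrow> None
                            | Some r \<Rightarrow> (case \<Gamma> r of None \<Rightarrow> None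
                                        | Some q \<Rightarrow> tfun e2 (bpair p q))))"

definition W_equiv where
  "W_equiv dX dY f dX' dY' g \<longleftrightarrow> W_le dX dY f dX' dY' g \<and> W_le dX' dY' g dX dY f"

definition LAY :: "(nat \<Rightarrow> (nat \<Rightarrow> bool) set) \<Rightarrow> (nat \<Rightarrow> bool) \<Rightarrow> nat set" where
  "LAY U X = (if X \<in> MLR then {i. X \<notin> U i} else {})"

definition rd :: "(nat \<Rightarrow> (nat \<Rightarrow> bool) set) \<Rightarrow> (nat \<Rightarrow> bool) \<Rightarrow> nat" where
  "rd U X = (LEAST i. X \<notin> U i)"

definition RD :: "(nat \<Rightarrow> (nat \<Rightarrow> bool) set) \<Rightarrow> (nat \<Rightarrow> bool) \<Rightarrow> nat set" where
  "RD U X = (if X \<in> MLR then {rd U X} else {})"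

end

theory Submission
  imports Defs
begin

text \<open>
  Given \<open>X \<in> MLR\<close>, let \<open>r i\<close> be the approximation to \<open>rd V X\<close> available at stage \<open>i\<close>. Compute \<open>Y\<close> by
  copying \<open>X\<close>, but whenever \<open>r i\<close> is seen to have been wrong, output zeros until \<open>Y\<close> has been
  enumerated into \<open>U i\<close>. This happens eventually, since a sequence ending in zeros is not random and
  hence lies in every component of a universal test. The approximation is wrong at finitely many stages
  only, so \<open>Y\<close> is a finite modification of \<open>X\<close> and thus random; and if \<open>Y \<notin> U i\<close>, then
  \<open>r i = rd V X\<close>. Hence \<open>RD V\<close> reduces to \<open>LAY U\<close>. Conversely, every realizer of \<open>RD V\<close>
  realizes \<open>LAY V\<close>, and \<open>LAY V\<close> computes \<open>RD U\<close>, hence \<open>LAY U\<close>.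
\<close>

section \<open>Computable functionals\<close>

text \<open>The obstacle is that \<open>rd V X\<close> is only a limit of computable guesses, and
  the reduction has no bound on when they settle, while an answer of \<open>LAY U\<close> says
  nothing about \<open>V\<close>. The way out is to read the answer \<open>i\<close> twice: as the
  index of a component of \<open>U\<close> and as a stage of the approximation to
  \<open>rd V X\<close>. Steering the query \<open>Y\<close> into every component whose index is a
  wrong stage leaves only indices at which the guess is right, whichever realizer answers. No
  relation between the indexings of \<open>U\<close> and \<open>V\<close> enters, so both tests may
  be arbitrary universal ones. The construction cannot know which guesses are wrong. It therefore
  compares each guess with the newest one; this can cause padding that the true value would not call
  for, but only finitely often. The two facts about randomness behind this are that
  \<open>MLR\<close> is closed under finite changes and that no member of it ends in zeros. The rest
  is computability: one program must work for all random \<open>X\<close> at once, and randomness of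
  \<open>X\<close> is what makes its searches halt.\<close>

inductive_cases ev_ZeroE: "ev p Zero xs y"
inductive_cases ev_SuccE: "ev p Succ xs y"
inductive_cases ev_ProjE: "ev p (Proj i) xs y"
inductive_cases ev_OracE: "ev p Orac xs y"
inductive_cases ev_CompE: "ev p (Comp f gs) xs y"
inductive_cases ev_PrecE: "ev p (Prec f g) xs y"
inductive_cases ev_Prec0E: "ev p (Prec f g) (0 # xs) y"
inductive_cases ev_PrecSE: "ev p (Prec f g) (Suc n # xs) y"
inductive_cases ev_MiniE: "ev p (Mini f) xs y"

text \<open>Determinism turns the description \<open>THE\<close> in \<open>tfun\<close> into the
  value that a program is shown to have.\<close>

lemma ev_det: "ev p e xs y \<Longrightarrow> ev p e xs z \<Longrightarrow> y = z"
proof (induction arbitrary: z rule: ev.induct)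
  case (ev_zero xs)
  then show ?case by (rule ev_ZeroE) simp
next
  case (ev_succ xs)
  then show ?case by (rule ev_SuccE) simp
next
  case (ev_proj i xs)
  then show ?case by (rule ev_ProjE) simp
next
  case (ev_orac xs)
  then show ?case by (rule ev_OracE) simp
next
  case (ev_comp xs gs ys f z')
  from ev_comp.prems obtain ys' where ys': "list_all2 (\<lambda>g y. ev p g xs y) gs ys'" "ev p f ys' z"
    by (rule ev_CompE)
  have "ys = ys'"
  proof (rule nth_equalityI)
    show "length ys = length ys'"
      using ev_comp.IH(1) ys'(1) by (auto dest!: list_all2_lengthD)
    show "ys ! i = ys' ! i" if "i < length ys" for i
      using that list_all2_nthD2[OF ev_comp.IH(1) that] list_all2_nthD[OF ys'(1), of i]
        list_all2_lengthD[OF ev_comp.IH(1)] by simp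
  qed
  then show ?case using ev_comp.IH(2) ys'(2) by blast
next
  case (ev_prec0 f xs y g)
  then show ?case by (blast elim: ev_Prec0E)
next
  case (ev_precS f g n xs y z')
  from ev_precS.prems obtain y' where "ev p (Prec f g) (n # xs) y'" "ev p g (n # y' # xs) z"
    by (rule ev_PrecSE)
  then show ?case using ev_precS.IH by blast
next
  case (ev_mini f n xs)
  from ev_mini.prems obtain fz: "ev p f (z # xs) 0"
      and z: "\<forall>m<z. \<exists>y. 0 < y \<and> ev p f (m # xs) y"
    by (rule ev_MiniE)
  have "\<not> n < z"
  proof
    assume "n < z"
    then obtain y where "0 < y" "ev p f (n # xs) y" using z by blast
    then show False using ev_mini.IH(1) by blast
  qed
  moreover have "\<not> z < n"
  proof
    assume "z < n"
    then obtain y where "0 < y" "\<And>u. ev p f (z # xs) u \<Longrightarrow> y = u"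
      using ev_mini.IH(2) by blast
    then show False using fz by blast
  qed
  ultimately show ?case by simp
qed

lemma tfun_eqI: "(\<And>n. ev p e [n] (F n)) \<Longrightarrow> tfun e p = Some F"
proof -
  assume ev: "\<And>n. ev p e [n] (F n)"
  then have "(THE y. ev p e [n] y) = F n" for n
    by (intro the_equality ev_det)
  then show ?thesis using ev unfolding tfun_def by (subst if_P) auto
qed

text \<open>A single program has to work for all contexts \<open>c \<in> D\<close>, where \<open>c\<close> determines the oracle \<open>orc c\<close>
  and the inputs \<open>map (\<lambda>v. v c) vs\<close>. Primitive recursion and search extend the context by the
  numbers they bind.\<close>

definition computable_on ::
    "'c set \<Rightarrow> ('c \<Rightarrow> nat \<Rightarrow> nat) \<Rightarrow> ('c \<Rightarrow> nat) list \<Rightarrow> ('c \<Rightarrow> nat) \<Rightarrow> bool" where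
  "computable_on D orc vs F \<longleftrightarrow> (\<exists>e. \<forall>c\<in>D. ev (orc c) e (map (\<lambda>v. v c) vs) (F c))"

abbreviation decidable_on ::
    "'c set \<Rightarrow> ('c \<Rightarrow> nat \<Rightarrow> nat) \<Rightarrow> ('c \<Rightarrow> nat) list \<Rightarrow> ('c \<Rightarrow> bool) \<Rightarrow> bool" where
  "decidable_on D orc vs P \<equiv> computable_on D orc vs (\<lambda>c. of_bool (P c))"

named_theorems comp_intros

section \<open>Closure properties of uniformly computable functions\<close>

lemma computable_cong:
  "computable_on D orc vs F \<Longrightarrow> (\<And>c. c \<in> D \<Longrightarrow> F c = G c) \<Longrightarrow> computable_on D orc vs G"
  by (simp add: computable_on_def cong: ball_cong)

lemma computable_var: "v \<in> set vs \<Longrightarrow> computable_on D orc vs v"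
proof -
  assume "v \<in> set vs"
  then obtain i where i: "i < length vs" "vs ! i = v" by (auto simp: in_set_conv_nth)
  have "ev (orc c) (Proj i) (map (\<lambda>v. v c) vs) (v c)" for c
    using ev_proj[of "orc c" i "map (\<lambda>v. v c) vs"] i by (simp add: arg_def)
  then show ?thesis unfolding computable_on_def by blast
qed

text \<open>The programs for the arguments are chosen per function in \<open>Gs\<close>, before any
  context is given, so a single composite program serves all contexts.\<close>

lemma computable_app:
  assumes e: "\<And>c. c \<in> D \<Longrightarrow> ev (orc c) e (map (\<lambda>G. G c) Gs) (F c)"
    and Gs: "\<And>G. G \<in> set Gs \<Longrightarrow> computable_on D orc vs G"
  shows "computable_on D orc vs F"
proof -
  have "\<forall>G\<in>set Gs. \<exists>e. \<forall>c\<in>D. ev (orc c) e (map (\<lambda>v. v c) vs) (G c)"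
    using Gs by (simp add: computable_on_def)
  from bchoice[OF this] obtain E where
    E: "\<And>G c. G \<in> set Gs \<Longrightarrow> c \<in> D \<Longrightarrow> ev (orc c) (E G) (map (\<lambda>v. v c) vs) (G c)"
    by blast
  have "ev (orc c) (Comp e (map E Gs)) (map (\<lambda>v. v c) vs) (F c)" if "c \<in> D" for c
    using that E by (intro ev_comp[OF _ e]) (auto simp: list_all2_conv_all_nth)
  then show ?thesis unfolding computable_on_def by blast
qed

lemma computable_oracle:
  assumes "computable_on D orc vs F"
  shows "computable_on D orc vs (\<lambda>c. orc c (F c))"
proof (rule computable_app[where Gs = "[F]" and e = Orac])
  fix c show "ev (orc c) Orac (map (\<lambda>G. G c) [F]) (orc c (F c))"
    using ev_orac[of "orc c" "[F c]"] by (simp add: arg_def)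
qed (use assms in auto)

lemma computable_Suc [comp_intros]:
  assumes "computable_on D orc vs F"
  shows "computable_on D orc vs (\<lambda>c. Suc (F c))"
proof (rule computable_app[where Gs = "[F]" and e = Succ])
  fix c show "ev (orc c) Succ (map (\<lambda>G. G c) [F]) (Suc (F c))"
    using ev_succ[of "orc c" "[F c]"] by (simp add: arg_def)
qed (use assms in auto)

lemma computable_const [comp_intros]: "computable_on D orc vs (\<lambda>c. k)"
proof (induction k)
  case 0
  show ?case unfolding computable_on_def by (intro exI[of _ Zero] ballI ev_zero)
qed (rule computable_Suc)

text \<open>The step is required to be computable for all counters and accumulators, not just those
  that the recursion reaches; this keeps the extended context a plain product.\<close>

lemma computable_rec [comp_intros]:
  assumes A: "computable_on D orc vs A" and N: "computable_on D orc vs N"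
    and B: "computable_on (UNIV \<times> UNIV \<times> D) (\<lambda>d. orc (snd (snd d)))
      (fst # (\<lambda>d. fst (snd d)) # map (\<lambda>v d. v (snd (snd d))) vs)
      (\<lambda>d. B (fst d) (fst (snd d)) (snd (snd d)))"
  shows "computable_on D orc vs (\<lambda>c. rec_nat (A c) (\<lambda>n r. B n r c) (N c))"
proof -
  obtain a where a: "\<And>c. c \<in> D \<Longrightarrow> ev (orc c) a (map (\<lambda>v. v c) vs) (A c)"
    using A unfolding computable_on_def by blast
  obtain b where b: "\<And>d. d \<in> UNIV \<times> UNIV \<times> D \<Longrightarrow> ev (orc (snd (snd d))) b
      (map (\<lambda>v. v d) (fst # (\<lambda>d. fst (snd d)) # map (\<lambda>v d. v (snd (snd d))) vs))
      (B (fst d) (fst (snd d)) (snd (snd d)))"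
    using B unfolding computable_on_def by blast
  have b: "ev (orc c) b (n # r # map (\<lambda>v. v c) vs) (B n r c)" if "c \<in> D" for n r c
    using b[of "(n, r, c)"] that by (simp add: comp_def)
  have "ev (orc c) (Prec a b) (n # map (\<lambda>v. v c) vs) (rec_nat (A c) (\<lambda>n r. B n r c) n)"
    if c: "c \<in> D" for c n
  proof (induction n)
    case 0
    show ?case using a[OF c] by (simp add: ev_prec0)
  next
    case (Suc n)
    show ?case using ev_precS[OF Suc b[OF c]] by simp
  qed
  then have "ev (orc c) (Prec a b) (map (\<lambda>G. G c) (N # vs)) (rec_nat (A c) (\<lambda>n r. B n r c) (N c))"
    if "c \<in> D" for c
    using that by simp
  moreover have "computable_on D orc vs G" if "G \<in> set (N # vs)" for G
    using that N by (cases "G = N") (simp_all add: computable_var)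
  ultimately show ?thesis by (rule computable_app)
qed

text \<open>Substitution along a map \<open>h\<close> of contexts. Usually \<open>h\<close> projects
  away the bound numbers, so that a function of the outer context can be used under a recursion or a
  search.\<close>

lemma computable_weaken:
  assumes "computable_on D orc vs F"
    and "\<And>d. d \<in> D' \<Longrightarrow> h d \<in> D" "\<And>d. d \<in> D' \<Longrightarrow> orc' d = orc (h d)"
    and "(\<lambda>v d. v (h d)) ` set vs \<subseteq> set vs'"
  shows "computable_on D' orc' vs' (\<lambda>d. F (h d))"
proof -
  obtain e where e: "\<And>c. c \<in> D \<Longrightarrow> ev (orc c) e (map (\<lambda>v. v c) vs) (F c)"
    using assms(1) unfolding computable_on_def by blast
  show ?thesis
  proof (rule computable_app)
    show "ev (orc' d) e (map (\<lambda>G. G d) (map (\<lambda>v d. v (h d)) vs)) (F (h d))" if "d \<in> D'" for d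
      using that e[of "h d"] assms(2,3)[of d] by (simp add: comp_def)
    show "computable_on D' orc' vs' G" if "G \<in> set (map (\<lambda>v d. v (h d)) vs)" for G
      using that assms(4) by (intro computable_var) auto
  qed
qed

lemma computable_if [comp_intros]:
  assumes "decidable_on D orc vs P" "computable_on D orc vs F" "computable_on D orc vs G"
  shows "computable_on D orc vs (\<lambda>c. if P c then F c else G c)"
proof -
  \<comment> \<open>A recursion of length 0 or 1 acts as a case distinction; both branches are
    total, so evaluating them is harmless.\<close>
  have "computable_on D orc vs (\<lambda>c. rec_nat (G c) (\<lambda>n r. F c) (of_bool (P c)))"
    by (intro computable_rec assms computable_weaken[OF assms(2), where h = "\<lambda>d. snd (snd d)"])
      (auto intro!: computable_var)
  then show ?thesis by (rule computable_cong) auto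
qed

lemma computable_add [comp_intros]:
  assumes "computable_on D orc vs F" "computable_on D orc vs G"
  shows "computable_on D orc vs (\<lambda>c. F c + G c)"
proof -
  have "computable_on D orc vs (\<lambda>c. rec_nat (F c) (\<lambda>n r. Suc r) (G c))"
    by (intro comp_intros assms)
      (auto intro!: computable_var)
  moreover have "rec_nat a (\<lambda>n r. Suc r) b = a + b" for a b by (induction b) auto
  ultimately show ?thesis by simp
qed

lemma computable_mult [comp_intros]:
  assumes "computable_on D orc vs F" "computable_on D orc vs G"
  shows "computable_on D orc vs (\<lambda>c. F c * G c)"
proof -
  have "computable_on D orc vs (\<lambda>c. rec_nat 0 (\<lambda>n r. r + F c) (G c))"
    by (intro comp_intros assms computable_weaken[OF assms(1), where h = "\<lambda>d. snd (snd d)"])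
      (auto intro!: computable_var)
  moreover have "rec_nat 0 (\<lambda>n r. r + a) b = a * b" for a b :: nat by (induction b) auto
  ultimately show ?thesis by simp
qed

lemma computable_diff [comp_intros]:
  assumes "computable_on D orc vs F" "computable_on D orc vs G"
  shows "computable_on D orc vs (\<lambda>c. F c - G c)"
proof -
  \<comment> \<open>The inner recursion is the predecessor, and truncated subtraction iterates
    it.\<close>
  have "computable_on D orc vs (\<lambda>c. rec_nat (F c) (\<lambda>n r. rec_nat 0 (\<lambda>m q. m) r) (G c))"
    by (intro comp_intros assms)
      (auto intro!: computable_var)
  moreover have pred: "rec_nat 0 (\<lambda>m q. m) r = r - 1" for r by (cases r) auto
  have "rec_nat a (\<lambda>n. rec_nat 0 (\<lambda>m q. m)) b = a - b" for a b :: nat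
    by (induction b) (simp_all add: pred)
  ultimately show ?thesis by simp
qed

lemma computable_power [comp_intros]:
  assumes "computable_on D orc vs F" "computable_on D orc vs G"
  shows "computable_on D orc vs (\<lambda>c. F c ^ G c)"
proof -
  have "computable_on D orc vs (\<lambda>c. rec_nat 1 (\<lambda>n r. r * F c) (G c))"
    by (intro comp_intros assms computable_weaken[OF assms(1), where h = "\<lambda>d. snd (snd d)"])
      (auto intro!: computable_var)
  moreover have "rec_nat 1 (\<lambda>n r. r * a) b = a ^ b" for a b :: nat by (induction b) auto
  ultimately show ?thesis by simp
qed

lemma decidable_eq [comp_intros]:
  assumes "computable_on D orc vs F" "computable_on D orc vs G"
  shows "decidable_on D orc vs (\<lambda>c. F c = G c)"
proof -
  have "computable_on D orc vs (\<lambda>c. 1 - ((F c - G c) + (G c - F c)))"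
    by (intro comp_intros assms)
  then show ?thesis by (rule computable_cong) auto
qed

lemma decidable_le [comp_intros]:
  assumes "computable_on D orc vs F" "computable_on D orc vs G"
  shows "decidable_on D orc vs (\<lambda>c. F c \<le> G c)"
proof -
  have "computable_on D orc vs (\<lambda>c. 1 - (F c - G c))" by (intro comp_intros assms)
  then show ?thesis by (rule computable_cong) auto
qed

lemma decidable_not [comp_intros]:
  assumes "decidable_on D orc vs P" shows "decidable_on D orc vs (\<lambda>c. \<not> P c)"
proof -
  have "computable_on D orc vs (\<lambda>c. 1 - of_bool (P c))" by (intro comp_intros assms)
  then show ?thesis by (rule computable_cong) auto
qed

lemma decidable_conj [comp_intros]:
  assumes "decidable_on D orc vs P" "decidable_on D orc vs Q"
  shows "decidable_on D orc vs (\<lambda>c. P c \<and> Q c)"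
proof -
  have "computable_on D orc vs (\<lambda>c. of_bool (P c) * of_bool (Q c))" by (intro comp_intros assms)
  then show ?thesis by (rule computable_cong) auto
qed

lemma decidable_disj [comp_intros]:
  assumes "decidable_on D orc vs P" "decidable_on D orc vs Q"
  shows "decidable_on D orc vs (\<lambda>c. P c \<or> Q c)"
proof -
  have "decidable_on D orc vs (\<lambda>c. \<not> (\<not> P c \<and> \<not> Q c))" by (intro comp_intros assms)
  then show ?thesis by simp
qed

lemma computable_Least:
  assumes P: "decidable_on (UNIV \<times> D) (\<lambda>d. orc (snd d)) (fst # map (\<lambda>v d. v (snd d)) vs)
      (\<lambda>d. P (fst d) (snd d))"
    and ex: "\<And>c. c \<in> D \<Longrightarrow> \<exists>n. P n c"
  shows "computable_on D orc vs (\<lambda>c. LEAST n. P n c)"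
proof -
  \<comment> \<open>\<open>Mini\<close> searches for the value 0, so its body has to decide the
    negation of \<open>P\<close>.\<close>
  have "decidable_on (UNIV \<times> D) (\<lambda>d. orc (snd d)) (fst # map (\<lambda>v d. v (snd d)) vs)
      (\<lambda>d. \<not> P (fst d) (snd d))"
    by (intro comp_intros P)
  then obtain b where b: "\<And>d. d \<in> UNIV \<times> D \<Longrightarrow> ev (orc (snd d)) b
      (map (\<lambda>v. v d) (fst # map (\<lambda>v d. v (snd d)) vs)) (of_bool (\<not> P (fst d) (snd d)))"
    unfolding computable_on_def by blast
  have b: "ev (orc c) b (n # map (\<lambda>v. v c) vs) (of_bool (\<not> P n c))" if "c \<in> D" for n c
    using b[of "(n, c)"] that by (simp add: comp_def)
  have "ev (orc c) (Mini b) (map (\<lambda>v. v c) vs) (LEAST n. P n c)" if c: "c \<in> D" for c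
  proof (rule ev_mini)
    have "P (LEAST n. P n c) c" using ex[OF c] by (metis LeastI)
    then show "ev (orc c) b ((LEAST n. P n c) # map (\<lambda>v. v c) vs) 0"
      using b[OF c, of "LEAST n. P n c"] by simp
    show "\<forall>m<LEAST n. P n c. \<exists>y>0. ev (orc c) b (m # map (\<lambda>v. v c) vs) y"
    proof (intro allI impI)
      fix m assume "m < (LEAST n. P n c)"
      then have "\<not> P m c" by (rule not_less_Least)
      then show "\<exists>y>0. ev (orc c) b (m # map (\<lambda>v. v c) vs) y"
        using b[OF c, of m] by (intro exI[of _ 1]) simp
    qed
  qed
  then show ?thesis unfolding computable_on_def by blast
qed

lemma decidable_bex [comp_intros]:
  assumes N: "computable_on D orc vs N"
    and P: "decidable_on (UNIV \<times> D) (\<lambda>d. orc (snd d)) (fst # map (\<lambda>v d. v (snd d)) vs)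
      (\<lambda>d. P (fst d) (snd d))"
  shows "decidable_on D orc vs (\<lambda>c. \<exists>n\<le>N c. P n c)"
proof -
  \<comment> \<open>The disjunct \<open>n = Suc (N c)\<close> makes the search halt in any case;
    stopping earlier means that a witness was found.\<close>
  have "computable_on D orc vs (\<lambda>c. LEAST n. n = Suc (N c) \<or> P n c)"
    by (rule computable_Least, intro comp_intros P computable_weaken[OF N, where h = snd])
      (auto intro!: computable_var)
  then have "decidable_on D orc vs (\<lambda>c. (LEAST n. n = Suc (N c) \<or> P n c) \<le> N c)"
    by (intro comp_intros N)
  then show ?thesis
  proof (rule computable_cong)
    fix c
    have "(LEAST n. n = Suc (N c) \<or> P n c) = Suc (N c) \<or> P (LEAST n. n = Suc (N c) \<or> P n c) c"
      by (rule LeastI_ex) auto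
    then have "(LEAST n. n = Suc (N c) \<or> P n c) \<le> N c \<longleftrightarrow> (\<exists>n\<le>N c. P n c)"
      by (metis (mono_tags, lifting) Least_le Suc_n_not_le_n le_trans)
    then show "of_bool ((LEAST n. n = Suc (N c) \<or> P n c) \<le> N c) = (of_bool (\<exists>n\<le>N c. P n c) :: nat)"
      by simp
  qed
qed

lemma decidable_ball [comp_intros]:
  assumes N: "computable_on D orc vs N"
    and P: "decidable_on (UNIV \<times> D) (\<lambda>d. orc (snd d)) (fst # map (\<lambda>v d. v (snd d)) vs)
      (\<lambda>d. P (fst d) (snd d))"
  shows "decidable_on D orc vs (\<lambda>c. \<forall>n\<le>N c. P n c)"
proof -
  have "decidable_on D orc vs (\<lambda>c. \<not> (\<exists>n\<le>N c. \<not> P n c))" by (intro comp_intros assms)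
  then show ?thesis by simp
qed

lemma computable_mod [comp_intros]:
  assumes "computable_on D orc vs F" "computable_on D orc vs G"
  shows "computable_on D orc vs (\<lambda>c. F c mod G c)"
proof -
  \<comment> \<open>A counter that resets on reaching \<open>G c\<close>. For divisor 0 it never
    resets, in accordance with \<open>a mod 0 = a\<close>.\<close>
  have "computable_on D orc vs (\<lambda>c. rec_nat 0 (\<lambda>n r. if Suc r = G c then 0 else Suc r) (F c))"
    by (intro comp_intros assms computable_weaken[OF assms(2), where h = "\<lambda>d. snd (snd d)"])
      (auto intro!: computable_var)
  moreover have "rec_nat 0 (\<lambda>n r. if Suc r = b then 0 else Suc r) a = a mod b" for a b :: nat
    by (induction a) (auto simp: mod_Suc)
  ultimately show ?thesis by simp
qed

lemma computable_prod_encode [comp_intros]: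
  assumes "computable_on D orc vs F" "computable_on D orc vs G"
  shows "computable_on D orc vs (\<lambda>c. prod_encode (F c, G c))"
proof -
  have "computable_on D orc vs (\<lambda>c. rec_nat 0 (\<lambda>n r. r + Suc n) (F c + G c) + F c)"
    by (intro comp_intros assms)
      (auto intro!: computable_var)
  moreover have "rec_nat 0 (\<lambda>n r. r + Suc n) a = triangle a" for a
    by (induction a) auto
  ultimately show ?thesis by (simp add: prod_encode_def)
qed

lemma computable_fst_prod_decode [comp_intros]:
  assumes "computable_on D orc vs F"
  shows "computable_on D orc vs (\<lambda>c. fst (prod_decode (F c)))"
proof -
  \<comment> \<open>A pair is coded by a number at least as large as its components, so the inner
    search for \<open>b\<close> can be bounded by \<open>F c\<close>.\<close>
  have "computable_on D orc vs (\<lambda>c. LEAST a. \<exists>b\<le>F c. prod_encode (a, b) = F c)"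
  proof (rule computable_Least)
    show "\<exists>a. \<exists>b\<le>F c. prod_encode (a, b) = F c" for c
      by (metis le_prod_encode_2 prod_decode_inverse surj_pair)
  qed (intro comp_intros computable_weaken[OF assms(1), where h = "snd"]
      computable_weaken[OF assms(1), where h = "\<lambda>d. snd (snd d)"];
      auto intro!: computable_var)
  then show ?thesis
  proof (rule computable_cong)
    fix c
    have "(\<exists>b\<le>F c. prod_encode (a, b) = F c) \<longleftrightarrow> a = fst (prod_decode (F c))" for a
      by (metis fst_conv le_prod_encode_2 prod_decode_inverse prod_encode_inverse surjective_pairing)
    then show "(LEAST a. \<exists>b\<le>F c. prod_encode (a, b) = F c) = fst (prod_decode (F c))"
      by (simp add: Least_equality)
  qed
qed

lemma computable_snd_prod_decode [comp_intros]:
  assumes "computable_on D orc vs F"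
  shows "computable_on D orc vs (\<lambda>c. snd (prod_decode (F c)))"
proof -
  have "computable_on D orc vs (\<lambda>c. LEAST b. prod_encode (fst (prod_decode (F c)), b) = F c)"
  proof (rule computable_Least)
    show "\<exists>b. prod_encode (fst (prod_decode (F c)), b) = F c" for c
      by (metis prod_decode_inverse surjective_pairing)
  qed (intro comp_intros computable_weaken[OF assms(1), where h = "snd"];
      auto intro!: computable_var)
  then show ?thesis
  proof (rule computable_cong)
    fix c
    have "prod_encode (fst (prod_decode (F c)), b) = F c \<longleftrightarrow> b = snd (prod_decode (F c))" for b
      by (metis prod_decode_inverse prod_encode_inverse snd_conv surjective_pairing)
    then show "(LEAST b. prod_encode (fst (prod_decode (F c)), b) = F c) = snd (prod_decode (F c))"
      by (simp add: Least_equality)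
  qed
qed

section \<open>Stages of computably enumerable sets\<close>

text \<open>All oracles are allowed, although the simulated computations have the zero oracle: the
  stages are later evaluated by programs whose oracle carries a random sequence.\<close>

definition clock_computable :: "nat \<Rightarrow> (nat \<Rightarrow> nat list \<Rightarrow> nat) \<Rightarrow> bool" where
  "clock_computable k T \<longleftrightarrow> (\<exists>e. \<forall>p s xs. length xs = k \<longrightarrow> ev p e (s # xs) (T s xs))"

text \<open>The context consists of oracle, clock and argument list. Inputs are numbers, so the list
  is passed entry by entry, which its fixed length \<open>k\<close> permits.\<close>

lemma clock_computableI:
  assumes "computable_on {c. length (snd (snd c)) = k} fst
    ((\<lambda>c. fst (snd c)) # map (\<lambda>i c. snd (snd c) ! i) [0..<k]) (\<lambda>c. T (fst (snd c)) (snd (snd c)))"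
  shows "clock_computable k T"
proof -
  obtain e where e: "\<And>c. length (snd (snd c)) = k \<Longrightarrow> ev (fst c) e
      (map (\<lambda>v. v c) ((\<lambda>c. fst (snd c)) # map (\<lambda>i c. snd (snd c) ! i) [0..<k]))
      (T (fst (snd c)) (snd (snd c)))"
    using assms unfolding computable_on_def by blast
  have "ev p e (s # xs) (T s xs)" if "length xs = k" for p s xs
    using e[of "(p, s, xs)"] that map_nth[of xs] by (simp add: comp_def)
  then show ?thesis unfolding clock_computable_def by blast
qed

lemma computable_clock:
  assumes "clock_computable k T" "computable_on D orc vs S" "length Gs = k"
    and Gs: "\<And>G. G \<in> set Gs \<Longrightarrow> computable_on D orc vs G"
    and L: "\<And>c. c \<in> D \<Longrightarrow> map (\<lambda>G. G c) Gs = L c"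
  shows "computable_on D orc vs (\<lambda>c. T (S c) (L c))"
proof -
  obtain e where e: "\<And>p s xs. length xs = k \<Longrightarrow> ev p e (s # xs) (T s xs)"
    using assms(1) unfolding clock_computable_def by blast
  have "ev (orc c) e (map (\<lambda>G. G c) (S # Gs)) (T (S c) (L c))" if "c \<in> D" for c
  proof -
    have "length (L c) = k" using assms(3) by (simp flip: L[OF that])
    then show ?thesis using e by (simp add: L[OF that])
  qed
  moreover have "computable_on D orc vs G" if "G \<in> set (S # Gs)" for G
    using that assms(2) Gs by (cases "G = S") simp_all
  ultimately show ?thesis by (rule computable_app)
qed

lemma decidable_list_all:
  assumes "\<And>g. g \<in> set gs \<Longrightarrow> decidable_on D orc vs (Q g)"
  shows "decidable_on D orc vs (\<lambda>c. \<forall>g\<in>set gs. Q g c)"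
  using assms
proof (induction gs)
  case Nil
  show ?case by (simp add: computable_const)
next
  case (Cons g gs)
  have "decidable_on D orc vs (\<lambda>c. Q g c \<and> (\<forall>g\<in>set gs. Q g c))"
    using Cons by (intro comp_intros) auto
  then show ?case by simp
qed

text \<open>\<open>T s xs\<close> is the result of \<open>s\<close> steps of computation: \<open>0\<close> if there is no value yet, and
  \<open>Suc y\<close> if the value \<open>y\<close> has been found.\<close>

definition clocks :: "nat \<Rightarrow> recf \<Rightarrow> (nat \<Rightarrow> nat list \<Rightarrow> nat) \<Rightarrow> bool" where
  "clocks k e T \<longleftrightarrow> clock_computable k T \<and>
    (\<forall>xs s y. length xs = k \<longrightarrow> T s xs = Suc y \<longrightarrow> ev (\<lambda>_. 0) e xs y) \<and>
    (\<forall>xs y. length xs = k \<longrightarrow> ev (\<lambda>_. 0) e xs y \<longrightarrow> (\<forall>\<^sub>F s in sequentially. T s xs = Suc y))"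

lemma clocksI:
  assumes "clock_computable k T"
    and "\<And>xs s y. length xs = k \<Longrightarrow> T s xs = Suc y \<Longrightarrow> ev (\<lambda>_. 0) e xs y"
    and "\<And>xs y. length xs = k \<Longrightarrow> ev (\<lambda>_. 0) e xs y \<Longrightarrow> \<forall>\<^sub>F s in sequentially. T s xs = Suc y"
  shows "clocks k e T"
  using assms unfolding clocks_def by blast

lemma clocksD:
  assumes "clocks k e T"
  shows "clock_computable k T"
    and "length xs = k \<Longrightarrow> T s xs = Suc y \<Longrightarrow> ev (\<lambda>_. 0) e xs y"
    and "length xs = k \<Longrightarrow> ev (\<lambda>_. 0) e xs y \<Longrightarrow> \<forall>\<^sub>F s in sequentially. T s xs = Suc y"
  using assms unfolding clocks_def by blast+

lemma computable_arg:
  "computable_on {c. length (snd (snd c)) = k} fst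
    ((\<lambda>c. fst (snd c)) # map (\<lambda>i c. snd (snd c) ! i) [0..<k]) (\<lambda>c. arg i (snd (snd c)))"
proof (cases "i < k")
  case True
  have "computable_on {c. length (snd (snd c)) = k} fst
    ((\<lambda>c. fst (snd c)) # map (\<lambda>i c. snd (snd c) ! i) [0..<k]) (\<lambda>c. snd (snd c) ! i)"
    using True by (intro computable_var) auto
  then show ?thesis by (rule computable_cong) (use True in \<open>simp add: arg_def\<close>)
next
  case False
  then show ?thesis by (intro computable_cong[OF computable_const[of _ _ _ 0]]) (simp add: arg_def)
qed

lemma computable_clock_Cons:
  assumes T: "clock_computable (Suc k) T" and F: "computable_on D orc vs F"
    and len: "\<And>d. d \<in> D \<Longrightarrow> length (snd (snd (h d))) = k"
    and sub: "(\<lambda>v d. v (h d)) ` set ((\<lambda>c. fst (snd c)) # map (\<lambda>i c. snd (snd c) ! i) [0..<k])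
      \<subseteq> set vs"
  shows "computable_on D orc vs (\<lambda>d. T (fst (snd (h d))) (F d # snd (snd (h d))))"
proof (rule computable_clock[OF T])
  let ?Gs = "map (\<lambda>i d. snd (snd (h d)) ! i) [0..<k]"
  show "computable_on D orc vs (\<lambda>d. fst (snd (h d)))" using sub by (intro computable_var) auto
  show "length (F # ?Gs) = Suc k" by simp
  show "map (\<lambda>G. G d) (F # ?Gs) = F d # snd (snd (h d))" if "d \<in> D" for d
    using len[OF that] map_nth[of "snd (snd (h d))"] by (simp add: comp_def)
  show "computable_on D orc vs G" if "G \<in> set (F # ?Gs)" for G
  proof (cases "G = F")
    case False
    then show ?thesis using that sub by (intro computable_var) auto
  qed (simp add: F)
qed

text \<open>Induction over programs with the arity generalised, since subprograms take other numbers
  of arguments. Only \<open>Mini\<close> consults the clock itself, as a bound on its search;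
  elsewhere it is passed on or ignored. Completeness is stated with \<open>eventually\<close>, so
  that the finitely many subcomputations of a converging one are found at a common stage.\<close>

lemma clocks_exists: "\<exists>T. clocks k e T"
proof (induction e arbitrary: k)
  case Zero
  have "clocks k Zero (\<lambda>s xs. Suc 0)"
  proof (rule clocksI)
    show "clock_computable k (\<lambda>s xs. Suc 0)" by (intro clock_computableI comp_intros)
  qed (auto intro: ev_zero elim!: ev_ZeroE)
  then show ?case by blast
next
  case Succ
  have "clocks k Succ (\<lambda>s xs. Suc (Suc (arg 0 xs)))"
  proof (rule clocksI)
    show "clock_computable k (\<lambda>s xs. Suc (Suc (arg 0 xs)))"
      by (intro clock_computableI comp_intros computable_arg)
  qed (auto intro: ev_succ elim!: ev_SuccE)
  then show ?case by blast
next
  case (Proj i)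
  have "clocks k (Proj i) (\<lambda>s xs. Suc (arg i xs))"
  proof (rule clocksI)
    show "clock_computable k (\<lambda>s xs. Suc (arg i xs))"
      by (intro clock_computableI comp_intros computable_arg)
  qed (auto intro: ev_proj elim!: ev_ProjE)
  then show ?case by blast
next
  case Orac
  \<comment> \<open>The zero oracle always answers 0, which is recorded as
    \<open>Suc 0\<close>.\<close>
  have "clocks k Orac (\<lambda>s xs. Suc 0)"
  proof (rule clocksI)
    show "clock_computable k (\<lambda>s xs. Suc 0)" by (intro clock_computableI comp_intros)
    show "ev (\<lambda>_. 0) Orac xs y" if "Suc 0 = Suc y" for xs y
      using that ev_orac[of "\<lambda>_. 0" xs] by simp
  qed (auto elim!: ev_OracE)
  then show ?case by blast
next
  case (Comp f gs)
  obtain Tf where Tf: "clocks (length gs) f Tf" using Comp.IH(1) by blast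
  have "\<forall>g\<in>set gs. \<exists>T. clocks k g T" using Comp.IH(2) by blast
  from bchoice[OF this] obtain Tg where Tg: "\<And>g. g \<in> set gs \<Longrightarrow> clocks k g (Tg g)" by blast
  define T where "T s xs =
    (if \<forall>g\<in>set gs. \<not> Tg g s xs = 0 then Tf s (map (\<lambda>g. Tg g s xs - 1) gs) else 0)" for s xs
  have "clocks k (Comp f gs) T"
  proof (rule clocksI)
    let ?vs = "((\<lambda>c. fst (snd c)) # map (\<lambda>i c. snd (snd c) ! i) [0..<k])
      :: ((nat \<Rightarrow> nat) \<times> nat \<times> nat list \<Rightarrow> nat) list"
    let ?D = "{c. length (snd (snd c)) = k} :: ((nat \<Rightarrow> nat) \<times> nat \<times> nat list) set"
    have s: "computable_on ?D fst ?vs (\<lambda>c. fst (snd c))" by (intro computable_var) simp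
    have g: "computable_on ?D fst ?vs (\<lambda>c. Tg g (fst (snd c)) (snd (snd c)))" if "g \<in> set gs" for g
    proof (rule computable_clock[OF clocksD(1)[OF Tg[OF that]] s])
      show "map (\<lambda>G. G c) (map (\<lambda>i c. snd (snd c) ! i) [0..<k]) = snd (snd c)" if "c \<in> ?D" for c
        using that map_nth[of "snd (snd c)"] by (simp add: comp_def)
    qed (auto intro: computable_var)
    have "computable_on ?D fst ?vs
      (\<lambda>c. Tf (fst (snd c)) (map (\<lambda>g. Tg g (fst (snd c)) (snd (snd c)) - 1) gs))"
    proof (rule computable_clock[OF clocksD(1)[OF Tf] s])
      show "map (\<lambda>G. G c) (map (\<lambda>g c. Tg g (fst (snd c)) (snd (snd c)) - 1) gs) =
        map (\<lambda>g. Tg g (fst (snd c)) (snd (snd c)) - 1) gs" for c :: "(nat \<Rightarrow> nat) \<times> nat \<times> nat list"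
        by (simp add: comp_def)
      fix G :: "(nat \<Rightarrow> nat) \<times> nat \<times> nat list \<Rightarrow> nat"
      assume "G \<in> set (map (\<lambda>g c. Tg g (fst (snd c)) (snd (snd c)) - 1) gs)"
      then obtain g' where "g' \<in> set gs" "G = (\<lambda>c. Tg g' (fst (snd c)) (snd (snd c)) - 1)" by auto
      then show "computable_on ?D fst ?vs G" by (auto intro!: comp_intros g)
    qed simp
    then show "clock_computable k T"
      unfolding T_def by (intro clock_computableI comp_intros decidable_list_all g)
  next
    fix xs s y assume k: "length xs = k" and "T s xs = Suc y"
    then have a: "\<forall>g\<in>set gs. \<not> Tg g s xs = 0" and b: "Tf s (map (\<lambda>g. Tg g s xs - 1) gs) = Suc y"
      by (auto simp: T_def split: if_splits)
    have "ev (\<lambda>_. 0) g xs (Tg g s xs - 1)" if "g \<in> set gs" for g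
      using that a by (intro clocksD(2)[OF Tg[OF that] k, of s]) auto
    moreover have "ev (\<lambda>_. 0) f (map (\<lambda>g. Tg g s xs - 1) gs) y"
      by (rule clocksD(2)[OF Tf _ b]) simp
    ultimately show "ev (\<lambda>_. 0) (Comp f gs) xs y"
      by (intro ev_comp) (auto simp: list_all2_conv_all_nth)
  next
    fix xs y assume k: "length xs = k" and "ev (\<lambda>_. 0) (Comp f gs) xs y"
    then obtain ys where ys: "list_all2 (\<lambda>g y. ev (\<lambda>_. 0) g xs y) gs ys" "ev (\<lambda>_. 0) f ys y"
      by (auto elim: ev_CompE)
    have len: "length ys = length gs" using list_all2_lengthD[OF ys(1)] by simp
    have "\<forall>\<^sub>F s in sequentially. \<forall>i\<in>{..<length gs}. Tg (gs ! i) s xs = Suc (ys ! i)"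
      using ys(1) by (intro eventually_ball_finite ballI clocksD(3)[OF Tg k])
        (auto simp: list_all2_conv_all_nth)
    moreover have "\<forall>\<^sub>F s in sequentially. Tf s ys = Suc y"
      by (rule clocksD(3)[OF Tf len ys(2)])
    ultimately show "\<forall>\<^sub>F s in sequentially. T s xs = Suc y"
    proof eventually_elim
      case (elim s)
      have "map (\<lambda>g. Tg g s xs - 1) gs = ys" using elim(1) len by (intro nth_equalityI) auto
      moreover have "\<forall>g\<in>set gs. Tg g s xs \<noteq> 0" using elim(1) by (auto simp: in_set_conv_nth)
      ultimately show ?case using elim(2) by (simp add: T_def)
    qed
  qed
  then show ?case by blast
next
  case (Prec f g)
  show ?case
  proof (cases k)
    case 0
    \<comment> \<open>Without a recursion variable no evaluation rule applies, so the clock never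
      reports a value.\<close>
    have "clocks 0 (Prec f g) (\<lambda>s xs. 0)"
    proof (rule clocksI)
      show "clock_computable 0 (\<lambda>s xs. 0)" by (intro clock_computableI comp_intros)
    qed (auto elim: ev_PrecE)
    then show ?thesis using 0 by blast
  next
    case (Suc l)
    obtain Tf Tg where Tf: "clocks l f Tf" and Tg: "clocks (Suc (Suc l)) g Tg"
      using Prec.IH by blast
    \<comment> \<open>An accumulator 0 means that an earlier value is still missing; it is kept, and
      otherwise decoded by subtracting 1.\<close>
    define T where "T s xs = rec_nat (Tf s (tl xs))
      (\<lambda>m r. if r = 0 then 0 else Tg s (m # (r - 1) # tl xs)) (xs ! 0)" for s xs
    have T_0: "T s (0 # zs) = Tf s zs" for s zs by (simp add: T_def)
    have T_Suc: "T s (Suc n # zs) =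
        (if T s (n # zs) = 0 then 0 else Tg s (n # (T s (n # zs) - 1) # zs))" for s n zs
      by (simp only: T_def list.sel nth_Cons_0 nat.rec)
    have "clocks k (Prec f g) T"
    proof (rule clocksI)
      let ?vs = "((\<lambda>c. fst (snd c)) # map (\<lambda>i c. snd (snd c) ! i) [0..<k])
        :: ((nat \<Rightarrow> nat) \<times> nat \<times> nat list \<Rightarrow> nat) list"
      let ?D = "{c. length (snd (snd c)) = k} :: ((nat \<Rightarrow> nat) \<times> nat \<times> nat list) set"
      let ?Gs = "map (\<lambda>i c. snd (snd c) ! Suc i) [0..<l]
        :: ((nat \<Rightarrow> nat) \<times> nat \<times> nat list \<Rightarrow> nat) list"
      have tl: "map ((!) xs \<circ> Suc) [0..<l] = tl xs" if "length xs = k" for xs :: "nat list"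
        using that Suc by (intro nth_equalityI) (auto simp: nth_tl)
      have s: "computable_on ?D fst ?vs (\<lambda>c. fst (snd c))" by (intro computable_var) simp
      have G: "computable_on ?D fst ?vs G" if "G \<in> set ?Gs" for G
        using that Suc by (intro computable_var) (auto simp del: upt_Suc)
      have 1: "computable_on ?D fst ?vs (\<lambda>c. Tf (fst (snd c)) (tl (snd (snd c))))"
      proof (rule computable_clock[OF clocksD(1)[OF Tf] s])
        show "map (\<lambda>G. G c) ?Gs = tl (snd (snd c))" if "c \<in> ?D" for c
          using that tl[of "snd (snd c)"] by (simp add: comp_def)
      qed (simp_all only: G length_map length_upt minus_nat.diff_0)
      let ?D' = "UNIV \<times> UNIV \<times> ?D"
      let ?orc = "\<lambda>d :: nat \<times> nat \<times> (nat \<Rightarrow> nat) \<times> nat \<times> nat list. fst (snd (snd d))"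
      let ?vs' = "fst # (\<lambda>d. fst (snd d)) # map (\<lambda>v d. v (snd (snd d))) ?vs"
      have w: "computable_on ?D' ?orc ?vs' (\<lambda>d. F (snd (snd d)))" if "computable_on ?D fst ?vs F" for F
        by (rule computable_weaken[OF that, where h = "\<lambda>d. snd (snd d)"]) auto
      have r: "computable_on ?D' ?orc ?vs' (\<lambda>d. fst (snd d))" by (intro computable_var) simp
      have 2: "computable_on ?D' ?orc ?vs'
        (\<lambda>d. Tg (fst (snd (snd (snd d)))) (fst d # (fst (snd d) - 1) # tl (snd (snd (snd (snd d))))))"
      proof (rule computable_clock[OF clocksD(1)[OF Tg] w[OF s],
            where Gs = "fst # (\<lambda>d. fst (snd d) - 1) # map (\<lambda>G d. G (snd (snd d))) ?Gs"])
        show "map (\<lambda>G. G d) (fst # (\<lambda>d. fst (snd d) - 1) # map (\<lambda>G d. G (snd (snd d))) ?Gs)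
          = fst d # (fst (snd d) - 1) # tl (snd (snd (snd (snd d))))" if "d \<in> ?D'" for d
          using that tl[of "snd (snd (snd (snd d)))"] by (auto simp: comp_def)
        fix G assume "G \<in> set (fst # (\<lambda>d. fst (snd d) - 1) # map (\<lambda>G d. G (snd (snd d))) ?Gs)"
        then consider "G = fst" | "G = (\<lambda>d. fst (snd d) - 1)"
          | G' where "G' \<in> set ?Gs" "G = (\<lambda>d. G' (snd (snd d)))"
          by (auto simp only: set_simps set_map)
        then show "computable_on ?D' ?orc ?vs' G"
        proof cases
          case 1 then show ?thesis by (auto intro!: computable_var)
        next
          case 2 then show ?thesis using r by (auto intro!: comp_intros)
        next
          case 3 then show ?thesis using w[OF G] by blast
        qed
      qed simp
      have 3: "computable_on ?D fst ?vs (\<lambda>c. snd (snd c) ! 0)"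
        using Suc by (intro computable_var) (auto simp del: upt_Suc)
      show "clock_computable k T"
        unfolding T_def
        by (intro clock_computableI computable_rec[OF 1 3] computable_if 2 comp_intros r)
    next
      fix xs s y assume k: "length xs = k" and T: "T s xs = Suc y"
      obtain n zs where xs: "xs = n # zs" "length zs = l" using k Suc by (cases xs) auto
      have "T s (n # zs) = Suc y \<Longrightarrow> ev (\<lambda>_. 0) (Prec f g) (n # zs) y"
      proof (induction n arbitrary: y)
        case 0
        then show ?case using clocksD(2)[OF Tf xs(2)] by (auto simp: T_0 intro: ev_prec0)
      next
        case (Suc n)
        let ?r = "T s (n # zs)"
        have r: "?r \<noteq> 0" and g: "Tg s (n # (?r - 1) # zs) = Suc y"
          using Suc.prems by (auto simp: T_Suc split: if_splits)
        show ?case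
        proof (rule ev_precS)
          show "ev (\<lambda>_. 0) (Prec f g) (n # zs) (?r - 1)" using r by (intro Suc.IH) simp
          show "ev (\<lambda>_. 0) g (n # (?r - 1) # zs) y" using g xs(2) by (intro clocksD(2)[OF Tg]) auto
        qed
      qed
      then show "ev (\<lambda>_. 0) (Prec f g) xs y" using T xs(1) by simp
    next
      fix xs y assume k: "length xs = k" and e: "ev (\<lambda>_. 0) (Prec f g) xs y"
      obtain n zs where xs: "xs = n # zs" "length zs = l" using k Suc by (cases xs) auto
      have "ev (\<lambda>_. 0) (Prec f g) (n # zs) y \<Longrightarrow> \<forall>\<^sub>F s in sequentially. T s (n # zs) = Suc y"
      proof (induction n arbitrary: y)
        case 0
        then have "ev (\<lambda>_. 0) f zs y" by (auto elim: ev_Prec0E)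
        from clocksD(3)[OF Tf xs(2) this] show ?case by (simp add: T_0)
      next
        case (Suc n)
        from Suc.prems obtain y' where y': "ev (\<lambda>_. 0) (Prec f g) (n # zs) y'"
            "ev (\<lambda>_. 0) g (n # y' # zs) y"
          by (rule ev_PrecSE)
        have "\<forall>\<^sub>F s in sequentially. Tg s (n # y' # zs) = Suc y"
          using xs(2) y'(2) by (intro clocksD(3)[OF Tg]) auto
        with Suc.IH[OF y'(1)] show ?case
          by eventually_elim (simp add: T_Suc)
      qed
      then show "\<forall>\<^sub>F s in sequentially. T s xs = Suc y" using e xs(1) by simp
    qed
    then show ?thesis by blast
  qed
next
  case (Mini f)
  obtain Tf where Tf: "clocks (Suc k) f Tf" using Mini.IH by blast
  \<comment> \<open>The scan passes over known positive values. It stops at a missing value (0), at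
    a found zero (1) or at the clock; only a found zero counts as success in
    \<open>T\<close>.\<close>
  define N where "N s xs = (LEAST n. Tf s (n # xs) \<le> 1 \<or> n = s)" for s xs
  define T where "T s xs = (if Tf s (N s xs # xs) = 1 then Suc (N s xs) else 0)" for s xs
  have "clocks k (Mini f) T"
  proof (rule clocksI)
    let ?vs = "((\<lambda>c. fst (snd c)) # map (\<lambda>i c. snd (snd c) ! i) [0..<k])
      :: ((nat \<Rightarrow> nat) \<times> nat \<times> nat list \<Rightarrow> nat) list"
    let ?D = "{c. length (snd (snd c)) = k} :: ((nat \<Rightarrow> nat) \<times> nat \<times> nat list) set"
    note f = computable_clock_Cons[OF clocksD(1)[OF Tf]]
    have s: "computable_on ?D fst ?vs (\<lambda>c. fst (snd c))" by (intro computable_var) simp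
    have N: "computable_on ?D fst ?vs (\<lambda>c. N (fst (snd c)) (snd (snd c)))"
      unfolding N_def
    proof (rule computable_Least)
      show "decidable_on (UNIV \<times> ?D) (\<lambda>d. fst (snd d)) (fst # map (\<lambda>v d. v (snd d)) ?vs)
        (\<lambda>d. Tf (fst (snd (snd d))) (fst d # snd (snd (snd d))) \<le> 1 \<or> fst d = fst (snd (snd d)))"
        by (intro comp_intros f[where h = snd]) (auto intro!: computable_var)
    qed auto
    have "computable_on ?D fst ?vs (\<lambda>c. Tf (fst (snd c)) (N (fst (snd c)) (snd (snd c)) # snd (snd c)))"
      by (rule f[OF N, where h = "\<lambda>c. c"]) auto
    then show "clock_computable k T"
      unfolding T_def by (intro clock_computableI comp_intros N)
  next
    fix xs s y assume k: "length xs = k" and "T s xs = Suc y"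
    then have y: "Tf s (y # xs) = 1" "N s xs = y" by (auto simp: T_def split: if_splits)
    show "ev (\<lambda>_. 0) (Mini f) xs y"
    proof (rule ev_mini)
      show "ev (\<lambda>_. 0) f (y # xs) 0" using y(1) k by (intro clocksD(2)[OF Tf]) auto
      show "\<forall>m<y. \<exists>z>0. ev (\<lambda>_. 0) f (m # xs) z"
      proof (intro allI impI)
        fix m assume "m < y"
        then have "\<not> Tf s (m # xs) \<le> 1" using not_less_Least y(2) unfolding N_def by blast
        then show "\<exists>z>0. ev (\<lambda>_. 0) f (m # xs) z"
          using k by (intro exI[of _ "Tf s (m # xs) - 1"] conjI clocksD(2)[OF Tf, of _ s]) auto
      qed
    qed
  next
    fix xs y assume k: "length xs = k" and "ev (\<lambda>_. 0) (Mini f) xs y"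
    then have y: "ev (\<lambda>_. 0) f (y # xs) 0" and "\<forall>m<y. \<exists>z. 0 < z \<and> ev (\<lambda>_. 0) f (m # xs) z"
      by (auto elim: ev_MiniE)
    then obtain Z where Z: "\<And>m. m < y \<Longrightarrow> 0 < Z m \<and> ev (\<lambda>_. 0) f (m # xs) (Z m)" by metis
    have "\<forall>\<^sub>F s in sequentially. Tf s (y # xs) = Suc 0"
      using k y by (intro clocksD(3)[OF Tf]) auto
    moreover have "\<forall>\<^sub>F s in sequentially. \<forall>m\<in>{..<y}. Tf s (m # xs) = Suc (Z m)"
      using k Z by (intro eventually_ball_finite ballI clocksD(3)[OF Tf]) auto
    \<comment> \<open>The clock must also have reached \<open>y\<close>, or the bound
      \<open>n = s\<close> would stop the scan too early.\<close>
    moreover have "\<forall>\<^sub>F s in sequentially. y \<le> s" by (rule eventually_ge_at_top)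
    ultimately show "\<forall>\<^sub>F s in sequentially. T s xs = Suc y"
    proof eventually_elim
      case (elim s)
      have "N s xs = y"
        unfolding N_def
      proof (rule Least_equality)
        fix m assume m: "Tf s (m # xs) \<le> 1 \<or> m = s"
        show "y \<le> m"
        proof (rule ccontr)
          assume "\<not> y \<le> m"
          then have "m < y" by simp
          then show False using m elim(2,3) Z[of m] by auto
        qed
      qed (use elim in auto)
      then show ?case using elim(1) by (simp add: T_def)
    qed
  qed
  then show ?case by blast
qed

text \<open>The reduction can test stages but not membership. Truth at all late stages lets several
  enumerations be met at one stage.\<close>

lemma ce_stages:
  assumes "ce A"
  obtains Q e where "\<And>p s n. ev p e [s, n] (of_bool (Q s n))"
    and "\<And>s n. Q s n \<Longrightarrow> n \<in> A" and "\<And>n. n \<in> A \<Longrightarrow> \<forall>\<^sub>F s in sequentially. Q s n"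
proof -
  obtain a where a: "\<And>n. n \<in> A \<longleftrightarrow> (\<exists>y. ev (\<lambda>_. 0) a [n] y)"
    using assms unfolding ce_def by blast
  obtain T where T: "clocks (Suc 0) a T" using clocks_exists by blast
  define Q where "Q s n \<longleftrightarrow> T s [n] \<noteq> 0" for s n
  have "decidable_on UNIV fst [\<lambda>c :: (nat \<Rightarrow> nat) \<times> nat \<times> nat. fst (snd c), \<lambda>c. snd (snd c)]
      (\<lambda>c. Q (fst (snd c)) (snd (snd c)))"
    unfolding Q_def
    by (intro comp_intros computable_clock[OF clocksD(1)[OF T], where Gs = "[\<lambda>c. snd (snd c)]"])
      (auto intro: computable_var)
  then obtain e where e: "\<And>c. ev (fst c) e [fst (snd c), snd (snd c)]
      (of_bool (Q (fst (snd c)) (snd (snd c))))"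
    unfolding computable_on_def by auto
  show ?thesis
  proof
    show "ev p e [s, n] (of_bool (Q s n))" for p s n using e[of "(p, s, n)"] by simp
    show "n \<in> A" if "Q s n" for s n
      using that a clocksD(2)[OF T, of "[n]" s "T s [n] - 1"] by (auto simp: Q_def)
    show "\<forall>\<^sub>F s in sequentially. Q s n" if n: "n \<in> A" for n
    proof -
      obtain y where "ev (\<lambda>_. 0) a [n] y" using n a by blast
      then have "\<forall>\<^sub>F s in sequentially. T s [n] = Suc y" by (intro clocksD(3)[OF T]) auto
      then show ?thesis by eventually_elim (simp add: Q_def)
    qed
  qed
qed

section \<open>Constructing computably enumerable sets\<close>

lemma ce_vimage:
  assumes "ce A" "computable_on UNIV (\<lambda>_ _. 0) [\<lambda>n. n] h"
  shows "ce {n. h n \<in> A}"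
proof -
  obtain a where a: "\<And>n. n \<in> A \<longleftrightarrow> (\<exists>y. ev (\<lambda>_. 0) a [n] y)"
    using assms(1) unfolding ce_def by blast
  obtain e where e: "\<And>n. ev (\<lambda>_. 0) e [n] (h n)"
    using assms(2) unfolding computable_on_def by auto
  have "ev (\<lambda>_. 0) (Comp a [e]) [n] y \<longleftrightarrow> ev (\<lambda>_. 0) a [h n] y" for n y
  proof
    assume "ev (\<lambda>_. 0) (Comp a [e]) [n] y"
    then obtain ys where "list_all2 (\<lambda>g y. ev (\<lambda>_. 0) g [n] y) [e] ys" "ev (\<lambda>_. 0) a ys y"
      by (rule ev_CompE)
    then show "ev (\<lambda>_. 0) a [h n] y"
      using ev_det[OF e] by (auto simp: list_all2_Cons1)
  qed (auto intro!: ev_comp[where ys = "[h n]"] e)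
  then show ?thesis using a unfolding ce_def by (intro exI[of _ "Comp a [e]"]) auto
qed

lemma ce_decidable:
  assumes "decidable_on UNIV (\<lambda>_ _. 0) [\<lambda>n. n] P"
  shows "ce {n. P n}"
proof -
  have "computable_on UNIV (\<lambda>_ _. 0) [\<lambda>n. n] (\<lambda>n. if P n then 0 else Suc 0)"
    by (intro comp_intros assms)
  \<comment> \<open>\<open>Proj 1\<close> ignores the search variable and returns the input, so the
    search halts exactly on input 0.\<close>
  moreover have "ce {0}"
  proof -
    have "ev (\<lambda>_. 0) (Mini (Proj 1)) [n] 0" if "n = 0" for n
      using that ev_mini[of "\<lambda>_. 0" "Proj 1" 0 "[0]"] ev_proj[of "\<lambda>_. 0" 1 "[0, 0]"] by (simp add: arg_def)
    moreover have "n = 0" if "ev (\<lambda>_. 0) (Mini (Proj 1)) [n] y" for n y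
      using that by (auto elim!: ev_MiniE ev_ProjE simp: arg_def)
    ultimately show ?thesis unfolding ce_def by (intro exI[of _ "Mini (Proj 1)"]) blast
  qed
  ultimately have "ce {n. (if P n then 0 else Suc 0) \<in> {0}}" by (rule ce_vimage[rotated])
  moreover have "{n. (if P n then 0 else Suc 0) \<in> {0}} = {n. P n}" by auto
  ultimately show ?thesis by simp
qed

section \<open>Cantor space\<close>

text \<open>\<open>code_str\<close> is base-2 notation with digits 1 and 2, least significant first,
  so the parity of a positive code reveals the first bit.\<close>

lemma code_str_inject: "code_str \<sigma> = code_str \<tau> \<longleftrightarrow> \<sigma> = \<tau>"
proof
  show "code_str \<sigma> = code_str \<tau> \<Longrightarrow> \<sigma> = \<tau>"
  proof (induction \<sigma> arbitrary: \<tau>)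
    case Nil
    then show ?case by (cases \<tau>) (auto split: if_splits)
  next
    case (Cons b \<sigma>)
    obtain b' \<tau>' where \<tau>: "\<tau> = b' # \<tau>'" using Cons.prems by (cases \<tau>) (auto split: if_splits)
    have "2 * code_str \<sigma> + (if b then 2 else 1) = 2 * code_str \<tau>' + (if b' then 2 else 1)"
      using Cons.prems \<tau> by simp
    then have "b = b' \<and> code_str \<sigma> = code_str \<tau>'" by (cases b; cases b') (simp_all, presburger+)
    then show ?case using Cons.IH \<tau> by simp
  qed
qed simp

lemma code_str_surj: "\<exists>\<sigma>. code_str \<sigma> = n"
proof (induction n rule: less_induct)
  case (less n)
  show ?case
  proof (cases "n = 0")
    case True
    then show ?thesis by (intro exI[of _ "[]"]) simp
  next
    case False
    then obtain \<sigma> where "code_str \<sigma> = (n - 1) div 2" using less[of "(n - 1) div 2"] by fastforce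
    then have "code_str (even n # \<sigma>) = n" using False by simp presburger
    then show ?thesis by blast
  qed
qed

lemma code_str_snoc: "code_str (\<sigma> @ [b]) = code_str \<sigma> + 2 ^ length \<sigma> * (1 + of_bool b)"
  by (induction \<sigma>) (auto simp: algebra_simps)

text \<open>\<open>Suc (code_str \<sigma>)\<close> is the binary number with the bits of \<sigma> as
  low digits, first bit lowest, and a leading 1 at position \<open>length \<sigma>\<close>. Taking a
  prefix keeps the low \<open>m\<close> digits and sets a new leading 1.\<close>

lemma Suc_code_str_take:
  "m \<le> length \<sigma> \<Longrightarrow> Suc (code_str (take m \<sigma>)) = 2 ^ m + Suc (code_str \<sigma>) mod 2 ^ m"
proof (induction \<sigma> arbitrary: m)
  case (Cons b \<sigma>)
  show ?case
  proof (cases m)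
    case (Suc l)
    let ?q = "Suc (code_str \<sigma>) mod 2 ^ l"
    have IH: "Suc (code_str (take l \<sigma>)) = 2 ^ l + ?q" using Cons Suc by simp
    have "Suc (code_str (b # \<sigma>)) = 2 * Suc (code_str \<sigma>) + of_bool b" by simp
    moreover have "(2 * a + of_bool b) mod (2 * d) = 2 * (a mod d) + of_bool b"
      if "d > 0" for a d :: nat
    proof -
      have "a mod d < d" using that by simp
      then have lt: "2 * (a mod d) + of_bool b < 2 * d" by (cases b) simp_all
      have "2 * a = 2 * (d * (a div d) + a mod d)" by simp
      also have "\<dots> = 2 * (a mod d) + 2 * d * (a div d)" by (simp only: distrib_left mult.assoc add.commute)
      finally have "2 * a + of_bool b = 2 * (a mod d) + of_bool b + 2 * d * (a div d)"
        by (simp only: add.assoc add.commute)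
      then have "(2 * a + of_bool b) mod (2 * d) = (2 * (a mod d) + of_bool b) mod (2 * d)"
        by (simp only: mod_mult_self2)
      then show ?thesis by (simp only: mod_less[OF lt])
    qed
    ultimately have "Suc (code_str (b # \<sigma>)) mod 2 ^ m = 2 * ?q + of_bool b"
      using Suc by (simp only: power_Suc zero_less_power zero_less_numeral)
    moreover have "Suc (code_str (take m (b # \<sigma>))) = 2 * Suc (code_str (take l \<sigma>)) + of_bool b"
      using Suc by simp
    ultimately show ?thesis unfolding IH using Suc by simp
  qed simp
qed simp

section \<open>Cylinders and the fair-coin measure\<close>

lemma mem_cyl_Nil [simp]: "X \<in> cyl []"
  by (simp add: cyl_def)

lemma mem_cyl_Cons: "X \<in> cyl (b # \<sigma>) \<longleftrightarrow> X 0 = b \<and> (\<lambda>n. X (Suc n)) \<in> cyl \<sigma>"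
  by (simp add: cyl_def All_less_Suc2)

lemma case_nat_mem_cyl [simp]: "case_nat b X \<in> cyl (b' # \<sigma>) \<longleftrightarrow> b = b' \<and> X \<in> cyl \<sigma>"
  by (simp add: mem_cyl_Cons)

lemma mem_cyl_map [simp]: "X \<in> cyl (map X [0..<n])"
  by (simp add: cyl_def)

lemma cyl_nonempty: "\<exists>X. X \<in> cyl \<sigma>"
  by (intro exI[of _ "\<lambda>i. \<sigma> ! i"]) (simp add: cyl_def)

text \<open>This provides \<open>cantor.PiM_iter\<close>: putting an independent fair bit in front
  preserves \<open>lam\<close>. The measure computations below split off the first bit in this
  way.\<close>

interpretation cantor: sequence_space "measure_pmf (bernoulli_pmf (1 / 2))"
  rewrites "Pi\<^sub>M UNIV (\<lambda>_::nat. measure_pmf (bernoulli_pmf (1 / 2))) = lam"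
  by unfold_locales (simp add: lam_def)

lemma space_lam [simp]: "space lam = UNIV"
  by (simp add: lam_def space_PiM)

lemma sets_cyl [measurable]: "cyl \<sigma> \<in> sets lam"
proof -
  have "{X \<in> space lam. X i = b} \<in> sets lam" for i b
  proof -
    have "(\<lambda>X. X i) \<in> measurable lam (measure_pmf (bernoulli_pmf (1 / 2)))"
      unfolding lam_def by (rule measurable_component_singleton) simp
    from measurable_sets[OF this, of "{b}"] show ?thesis by (simp add: vimage_def)
  qed
  then have "{X \<in> space lam. \<forall>i\<in>{..<length \<sigma>}. X i = \<sigma> ! i} \<in> sets lam"
    by (intro sets.sets_Collect_finite_All) auto
  moreover have "{X \<in> space lam. \<forall>i\<in>{..<length \<sigma>}. X i = \<sigma> ! i} = cyl \<sigma>"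
    by (auto simp: cyl_def)
  ultimately show ?thesis by simp
qed

lemma sets_cantor_open: "cantor_open W \<Longrightarrow> W \<in> sets lam"
proof -
  assume "cantor_open W"
  then have "W = \<Union> (cyl ` {\<sigma>. cyl \<sigma> \<subseteq> W})" unfolding cantor_open_def by blast
  also have "\<dots> \<in> sets lam" by (intro sets.countable_UN') auto
  finally show ?thesis .
qed

lemma emeasure_lam_cons:
  assumes "A \<in> sets lam"
  shows "emeasure lam A = emeasure (measure_pmf (bernoulli_pmf (1 / 2)) \<Otimes>\<^sub>M lam)
    {(b, X). case_nat b X \<in> A}"
proof -
  have "emeasure lam A = emeasure (distr (measure_pmf (bernoulli_pmf (1 / 2)) \<Otimes>\<^sub>M lam) lam
      (\<lambda>(b, X). case_nat b X)) A"
    by (simp only: cantor.PiM_iter)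
  also have "\<dots> = emeasure (measure_pmf (bernoulli_pmf (1 / 2)) \<Otimes>\<^sub>M lam)
      ((\<lambda>(b, X). case_nat b X) -` A \<inter> space (measure_pmf (bernoulli_pmf (1 / 2)) \<Otimes>\<^sub>M lam))"
    using assms by (intro emeasure_distr) (simp_all add: lam_def)
  also have "(\<lambda>(b, X). case_nat b X) -` A \<inter> space (measure_pmf (bernoulli_pmf (1 / 2)) \<Otimes>\<^sub>M lam)
      = {(b, X). case_nat b X \<in> A}"
    by (auto simp: space_pair_measure)
  finally show ?thesis .
qed

section \<open>Random sequences\<close>

definition cyl_codes :: "(nat \<Rightarrow> (nat \<Rightarrow> bool) set) \<Rightarrow> nat set" where
  "cyl_codes V = {prod_encode (i, code_str \<sigma>) | i \<sigma>. cyl \<sigma> \<subseteq> V i}"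

lemma mem_cyl_codes [simp]: "prod_encode (i, code_str \<sigma>) \<in> cyl_codes V \<longleftrightarrow> cyl \<sigma> \<subseteq> V i"
  by (auto simp: cyl_codes_def code_str_inject)

lemma prod_encode_code_str_cases: obtains i \<sigma> where "n = prod_encode (i, code_str \<sigma>)"
  by (metis code_str_surj prod_decode_inverse surj_pair)

lemma cyl_codes_eqI:
  assumes "\<And>i \<sigma>. P (prod_encode (i, code_str \<sigma>)) \<longleftrightarrow> cyl \<sigma> \<subseteq> V i"
  shows "cyl_codes V = {n. P n}"
proof (rule set_eqI)
  fix n
  show "n \<in> cyl_codes V \<longleftrightarrow> n \<in> {n. P n}"
    by (rule prod_encode_code_str_cases[of n]) (simp add: assms)
qed

lemma mltestD:
  assumes "mltest V"
  shows "cantor_open (V i)" "ce (cyl_codes V)" "emeasure lam (V i) \<le> ennreal ((1 / 2) ^ i)"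
  using assms unfolding mltest_def cyl_codes_def by blast+

lemma mltestI:
  assumes "\<And>i. cantor_open (V i)" "ce (cyl_codes V)"
    and "\<And>i. emeasure lam (V i) \<le> ennreal ((1 / 2) ^ i)"
  shows "mltest V"
  using assms unfolding mltest_def cyl_codes_def by blast

text \<open>This reduces codes of a test pulled back along the tail map to codes of the given test.
  The convention \<open>tl [] = []\<close> fits, as the tail map is onto.\<close>

lemma cyl_tl_subset_iff: "cyl \<sigma> \<subseteq> {X. (\<lambda>n. X (Suc n)) \<in> W} \<longleftrightarrow> cyl (tl \<sigma>) \<subseteq> W"
proof
  assume l: "cyl \<sigma> \<subseteq> {X. (\<lambda>n. X (Suc n)) \<in> W}"
  show "cyl (tl \<sigma>) \<subseteq> W"
  proof
    fix X assume "X \<in> cyl (tl \<sigma>)"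
    then have "case_nat (hd \<sigma>) X \<in> cyl \<sigma>" by (cases \<sigma>) simp_all
    from subsetD[OF l this] show "X \<in> W" by simp
  qed
next
  assume "cyl (tl \<sigma>) \<subseteq> W"
  then show "cyl \<sigma> \<subseteq> {X. (\<lambda>n. X (Suc n)) \<in> W}" by (cases \<sigma>) (auto simp: mem_cyl_Cons)
qed

lemma cyl_Cons_subset_iff: "cyl \<sigma> \<subseteq> {X. case_nat b X \<in> W} \<longleftrightarrow> cyl (b # \<sigma>) \<subseteq> W"
proof
  assume l: "cyl \<sigma> \<subseteq> {X. case_nat b X \<in> W}"
  show "cyl (b # \<sigma>) \<subseteq> W"
  proof
    fix X assume "X \<in> cyl (b # \<sigma>)"
    then have X: "X 0 = b" "(\<lambda>n. X (Suc n)) \<in> cyl \<sigma>" by (simp_all add: mem_cyl_Cons)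
    have "case_nat b (\<lambda>n. X (Suc n)) = X" using X(1) by (intro ext) (simp split: nat.split)
    with subsetD[OF l X(2)] show "X \<in> W" by simp
  qed
next
  assume l: "cyl (b # \<sigma>) \<subseteq> W"
  show "cyl \<sigma> \<subseteq> {X. case_nat b X \<in> W}"
  proof
    fix X assume "X \<in> cyl \<sigma>"
    then show "X \<in> {X. case_nat b X \<in> W}" using subsetD[OF l, of "case_nat b X"] by simp
  qed
qed

lemma cantor_openD_cyl_map:
  assumes "cantor_open W" "X \<in> W"
  obtains n where "cyl (map X [0..<n]) \<subseteq> W"
proof -
  obtain \<sigma> where "X \<in> cyl \<sigma>" "cyl \<sigma> \<subseteq> W" using assms unfolding cantor_open_def by blast
  moreover from this have "map X [0..<length \<sigma>] = \<sigma>" by (intro nth_equalityI) (auto simp: cyl_def)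
  ultimately show ?thesis using that[of "length \<sigma>"] by simp
qed

section \<open>Randomness is invariant under finite changes\<close>

lemma emeasure_lam_tl:
  assumes "{X. (\<lambda>n. X (Suc n)) \<in> W} \<in> sets lam" "W \<in> sets lam"
  shows "emeasure lam {X. (\<lambda>n. X (Suc n)) \<in> W} = emeasure lam W"
proof -
  have "{(b, X). case_nat b X \<in> {X. (\<lambda>n. X (Suc n)) \<in> W}} = UNIV \<times> W" by fastforce
  then have "emeasure lam {X. (\<lambda>n. X (Suc n)) \<in> W} =
      emeasure (measure_pmf (bernoulli_pmf (1 / 2)) \<Otimes>\<^sub>M lam) (UNIV \<times> W)"
    using emeasure_lam_cons[OF assms(1)] by simp
  also have "\<dots> = emeasure (measure_pmf (bernoulli_pmf (1 / 2))) UNIV * emeasure lam W"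
    using assms(2) by (intro cantor.P.emeasure_pair_measure_Times) auto
  finally show ?thesis by simp
qed

text \<open>The sequences in \<open>W\<close> that start with \<open>b\<close> form a copy of the
  slice at half its measure.\<close>

lemma emeasure_lam_slice_le:
  assumes "{X. case_nat b X \<in> W} \<in> sets lam" "W \<in> sets lam"
  shows "ennreal (1 / 2) * emeasure lam {X. case_nat b X \<in> W} \<le> emeasure lam W"
proof -
  let ?M = "measure_pmf (bernoulli_pmf (1 / 2))"
  have "ennreal (1 / 2) * emeasure lam {X. case_nat b X \<in> W} =
      emeasure (?M \<Otimes>\<^sub>M lam) ({b} \<times> {X. case_nat b X \<in> W})"
    using assms(1) by (subst cantor.P.emeasure_pair_measure_Times)
      (auto simp: emeasure_pmf_single pmf_bernoulli_half)
  also have "\<dots> \<le> emeasure (?M \<Otimes>\<^sub>M lam) {(b, X). case_nat b X \<in> W}"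
  proof (rule emeasure_mono)
    have "(\<lambda>(b, X). case_nat b X) -` W \<inter> space (?M \<Otimes>\<^sub>M lam) \<in> sets (?M \<Otimes>\<^sub>M lam)"
      using assms(2) by (intro measurable_sets[of _ _ lam]) (simp_all add: lam_def)
    then show "{(b, X). case_nat b X \<in> W} \<in> sets (?M \<Otimes>\<^sub>M lam)"
      by (simp add: space_pair_measure vimage_def case_prod_beta')
  qed auto
  finally show ?thesis using emeasure_lam_cons[OF assms(2)] by simp
qed

text \<open>A test that captures the tail pulls back along the measure-preserving tail map to one
  that captures \<open>X\<close>.\<close>

lemma MLR_tl:
  assumes "X \<in> MLR" shows "(\<lambda>n. X (Suc n)) \<in> MLR"
proof (rule ccontr)
  assume "(\<lambda>n. X (Suc n)) \<notin> MLR"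
  then obtain W where W: "mltest W" "(\<lambda>n. X (Suc n)) \<in> (\<Inter>i. W i)" by (auto simp: MLR_def)
  define W' where "W' i = {X. (\<lambda>n. X (Suc n)) \<in> W i}" for i
  have op: "cantor_open (W' i)" for i
    unfolding cantor_open_def
  proof
    fix Y assume "Y \<in> W' i"
    then obtain n where "cyl (map (\<lambda>n. Y (Suc n)) [0..<n]) \<subseteq> W i"
      using cantor_openD_cyl_map[OF mltestD(1)[OF W(1)]] unfolding W'_def by blast
    then have "cyl (tl (map Y [0..<Suc n])) \<subseteq> W i"
      by (simp add: map_upt_Suc del: upt_Suc)
    then have "cyl (map Y [0..<Suc n]) \<subseteq> W' i" unfolding W'_def cyl_tl_subset_iff .
    then show "\<exists>\<sigma>. Y \<in> cyl \<sigma> \<and> cyl \<sigma> \<subseteq> W' i" using mem_cyl_map by blast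
  qed
  have "mltest W'"
  proof (rule mltestI[OF op])
    \<comment> \<open>The strings \<open>b # \<tau>\<close> have codes \<open>2 * q + 1\<close> and
      \<open>2 * q + 2\<close> with \<open>q = code_str \<tau>\<close>, so the least
      \<open>q\<close> is the code of the tail; code 0 gives 0, as it should for the empty
      string.\<close>
    let ?h = "\<lambda>n. prod_encode (fst (prod_decode n), LEAST q. snd (prod_decode n) \<le> 2 * q + 2)"
    have "computable_on UNIV (\<lambda>_ _. 0) [\<lambda>n. n] ?h"
    proof (intro comp_intros computable_Least)
      show "\<exists>q. snd (prod_decode n) \<le> 2 * q + 2" for n
        by (rule exI[of _ "snd (prod_decode n)"]) simp
    qed (auto intro!: computable_var)
    moreover have "cyl_codes W' = {n. ?h n \<in> cyl_codes W}"
    proof (rule cyl_codes_eqI)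
      fix i \<sigma>
      have "(LEAST q. code_str \<sigma> \<le> 2 * q + 2) = code_str (tl \<sigma>)"
        by (rule Least_equality; cases \<sigma>) (auto split: if_splits)
      then show "?h (prod_encode (i, code_str \<sigma>)) \<in> cyl_codes W \<longleftrightarrow> cyl \<sigma> \<subseteq> W' i"
        by (simp add: W'_def cyl_tl_subset_iff)
    qed
    ultimately show "ce (cyl_codes W')" using ce_vimage[OF mltestD(2)[OF W(1)]] by simp
    show "emeasure lam (W' i) \<le> ennreal ((1 / 2) ^ i)" for i
      using emeasure_lam_tl[of "W i"] sets_cantor_open[OF op[of i]]
        sets_cantor_open[OF mltestD(1)[OF W(1)]] mltestD(3)[OF W(1), of i]
      by (simp add: W'_def)
  qed
  moreover have "X \<in> (\<Inter>i. W' i)" using W(2) by (auto simp: W'_def)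
  ultimately show False using assms by (auto simp: MLR_def)
qed

text \<open>Fixing the first bit at most doubles the measure; passing to the component
  \<open>Suc i\<close> pays for this factor.\<close>

lemma MLR_case_nat:
  assumes "X \<in> MLR" shows "case_nat b X \<in> MLR"
proof (rule ccontr)
  assume "case_nat b X \<notin> MLR"
  then obtain W where W: "mltest W" "case_nat b X \<in> (\<Inter>i. W i)" by (auto simp: MLR_def)
  define W' where "W' i = {X. case_nat b X \<in> W (Suc i)}" for i
  have op: "cantor_open (W' i)" for i
    unfolding cantor_open_def
  proof
    fix Y assume "Y \<in> W' i"
    then obtain \<sigma> where \<sigma>: "case_nat b Y \<in> cyl \<sigma>" "cyl \<sigma> \<subseteq> W (Suc i)"
      using mltestD(1)[OF W(1)] unfolding W'_def cantor_open_def by blast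
    then have "Y \<in> cyl (tl \<sigma>)" by (cases \<sigma>) auto
    moreover have "cyl (b # tl \<sigma>) \<subseteq> W (Suc i)" using \<sigma> by (cases \<sigma>) auto
    ultimately show "\<exists>\<sigma>. Y \<in> cyl \<sigma> \<and> cyl \<sigma> \<subseteq> W' i"
      unfolding W'_def using cyl_Cons_subset_iff by blast
  qed
  have "mltest W'"
  proof (rule mltestI[OF op])
    let ?h = "\<lambda>n. prod_encode (Suc (fst (prod_decode n)), 2 * snd (prod_decode n) + (if b then 2 else 1))"
    have "computable_on UNIV (\<lambda>_ _. 0) [\<lambda>n. n] ?h"
      by (intro comp_intros) (auto intro!: computable_var)
    moreover have "cyl_codes W' = {n. ?h n \<in> cyl_codes W}"
    proof (rule cyl_codes_eqI)
      fix i \<sigma>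
      have "?h (prod_encode (i, code_str \<sigma>)) = prod_encode (Suc i, code_str (b # \<sigma>))" by simp
      then show "?h (prod_encode (i, code_str \<sigma>)) \<in> cyl_codes W \<longleftrightarrow> cyl \<sigma> \<subseteq> W' i"
        by (simp only: mem_cyl_codes W'_def cyl_Cons_subset_iff)
    qed
    ultimately show "ce (cyl_codes W')" using ce_vimage[OF mltestD(2)[OF W(1)]] by simp
    show "emeasure lam (W' i) \<le> ennreal ((1 / 2) ^ i)" for i
    proof -
      have "emeasure lam (W' i) = ennreal 2 * (ennreal (1 / 2) * emeasure lam (W' i))"
        by (simp only: mult.assoc[symmetric] ennreal_mult[symmetric]) simp
      also have "\<dots> \<le> ennreal 2 * emeasure lam (W (Suc i))"
        using emeasure_lam_slice_le[of b "W (Suc i)"] sets_cantor_open[OF op[of i]]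
          sets_cantor_open[OF mltestD(1)[OF W(1)]]
        by (intro mult_left_mono) (simp_all add: W'_def)
      also have "\<dots> \<le> ennreal 2 * ennreal ((1 / 2) ^ Suc i)"
        by (intro mult_left_mono mltestD(3)[OF W(1)]) simp
      also have "\<dots> = ennreal ((1 / 2) ^ i)" by (subst ennreal_mult[symmetric]) simp_all
      finally show ?thesis .
    qed
  qed
  moreover have "X \<in> (\<Inter>i. W' i)" using W(2) by (auto simp: W'_def)
  ultimately show False using assms by (auto simp: MLR_def)
qed

text \<open>Induction on a bound \<open>N\<close> for the disagreements: drop the first bit, change
  the tail, put the first bit of \<open>Y\<close> in front.\<close>

lemma MLR_finite_change:
  assumes "X \<in> MLR" "\<forall>\<^sub>F n in sequentially. Y n = X n"
  shows "Y \<in> MLR"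
proof -
  obtain N where "\<forall>n\<ge>N. Y n = X n" using assms(2) by (auto simp: eventually_sequentially)
  with assms(1) show ?thesis
  proof (induction N arbitrary: X Y)
    case 0
    then have "Y = X" by (intro ext) simp
    then show ?case using 0 by simp
  next
    case (Suc N)
    have "(\<lambda>n. Y (Suc n)) \<in> MLR"
      using Suc.prems(2) by (intro Suc.IH[OF MLR_tl[OF Suc.prems(1)]]) simp
    then have "case_nat (Y 0) (\<lambda>n. Y (Suc n)) \<in> MLR" by (rule MLR_case_nat)
    moreover have "case_nat (Y 0) (\<lambda>n. Y (Suc n)) = Y" by (intro ext) (simp split: nat.split)
    ultimately show ?case by simp
  qed
qed

section \<open>Sequences ending in zeros are not random\<close>

lemma emeasure_cyl: "emeasure lam (cyl \<sigma>) = ennreal ((1 / 2) ^ length \<sigma>)"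
proof (induction \<sigma>)
  case Nil
  have "cyl [] = space lam" by (auto simp: cyl_def)
  then show ?case using cantor.P.emeasure_space_1 by simp
next
  case (Cons b \<sigma>)
  have "{(b', X). case_nat b' X \<in> cyl (b # \<sigma>)} = {b} \<times> cyl \<sigma>" by auto
  then have "emeasure lam (cyl (b # \<sigma>)) =
      emeasure (measure_pmf (bernoulli_pmf (1 / 2)) \<Otimes>\<^sub>M lam) ({b} \<times> cyl \<sigma>)"
    using emeasure_lam_cons[OF sets_cyl, of "b # \<sigma>"] by simp
  also have "\<dots> = ennreal (1 / 2) * emeasure lam (cyl \<sigma>)"
    by (subst cantor.P.emeasure_pair_measure_Times)
      (auto simp: emeasure_pmf_single pmf_bernoulli_half sets_cyl)
  also have "\<dots> = ennreal ((1 / 2) ^ length (b # \<sigma>))"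
    unfolding Cons.IH by (subst ennreal_mult[symmetric]) simp_all
  finally show ?case .
qed

text \<open>In the binary reading of \<open>Suc (code_str \<sigma>)\<close>, divisibility by
  \<open>2 ^ i\<close> says that the lowest \<open>i\<close> digits vanish. The leading 1 rules out
  strings shorter than \<open>i\<close>, so these digits are the first bits of \<sigma>.\<close>

lemma cyl_subset_zeros_iff:
  "cyl \<sigma> \<subseteq> cyl (replicate i False) \<longleftrightarrow> Suc (code_str \<sigma>) mod 2 ^ i = 0"
proof (induction i arbitrary: \<sigma>)
  case (Suc i)
  show ?case
  proof (cases \<sigma>)
    case Nil
    have "(\<lambda>_. True) \<notin> cyl (replicate (Suc i) False)" by (simp add: mem_cyl_Cons)
    then have "\<not> cyl \<sigma> \<subseteq> cyl (replicate (Suc i) False)" using Nil by (auto simp: cyl_def)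
    then show ?thesis using Nil by simp
  next
    case (Cons b \<tau>)
    have "cyl (b # \<tau>) \<subseteq> cyl (False # replicate i False) \<longleftrightarrow> \<not> b \<and> cyl \<tau> \<subseteq> cyl (replicate i False)"
    proof
      assume l: "cyl (b # \<tau>) \<subseteq> cyl (False # replicate i False)"
      have "\<not> b \<and> X \<in> cyl (replicate i False)" if "X \<in> cyl \<tau>" for X
      proof -
        have "case_nat b X \<in> cyl (False # replicate i False)" using that by (intro subsetD[OF l]) simp
        then show ?thesis by simp
      qed
      then show "\<not> b \<and> cyl \<tau> \<subseteq> cyl (replicate i False)" using cyl_nonempty[of \<tau>] by blast
    qed (auto simp: mem_cyl_Cons)
    moreover have "Suc (code_str (b # \<tau>)) mod 2 ^ Suc i = 0 \<longleftrightarrow>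
        \<not> b \<and> Suc (code_str \<tau>) mod 2 ^ i = 0"
    proof (cases b)
      case True
      then have "odd (Suc (code_str (b # \<tau>)))" by simp
      then have "\<not> 2 ^ Suc i dvd Suc (code_str (b # \<tau>))"
        by (meson dvd_power dvd_trans zero_less_Suc)
      then show ?thesis using True by (simp only: dvd_eq_mod_eq_0) simp
    next
      case False
      then have "Suc (code_str (b # \<tau>)) = 2 * Suc (code_str \<tau>)" by simp
      then show ?thesis using False by (simp only: power_Suc mod_mult_mult1) simp
    qed
    ultimately show ?thesis using Suc.IH[of \<tau>] Cons by simp
  qed
qed (simp add: cyl_def)

text \<open>By invariance under finite changes only the zero sequence matters, and the cylinders of
  \<open>i\<close> zeros form a test that captures it.\<close>

lemma eventually_False_not_MLR:
  assumes "\<forall>\<^sub>F n in sequentially. \<not> X n" shows "X \<notin> MLR"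
proof
  assume "X \<in> MLR"
  then have 0: "(\<lambda>_. False) \<in> MLR"
    by (rule MLR_finite_change) (use assms in \<open>simp add: eventually_mono\<close>)
  define W where "W i = cyl (replicate i False)" for i
  have "mltest W"
  proof (rule mltestI)
    show "cantor_open (W i)" for i unfolding W_def cantor_open_def by blast
    have "decidable_on UNIV (\<lambda>_ _. 0) [\<lambda>n. n]
        (\<lambda>n. Suc (snd (prod_decode n)) mod 2 ^ fst (prod_decode n) = 0)"
      by (intro comp_intros) (auto intro!: computable_var)
    then have "ce {n. Suc (snd (prod_decode n)) mod 2 ^ fst (prod_decode n) = 0}"
      by (rule ce_decidable)
    moreover have "cyl_codes W = {n. Suc (snd (prod_decode n)) mod 2 ^ fst (prod_decode n) = 0}"
      by (rule cyl_codes_eqI) (simp add: W_def cyl_subset_zeros_iff)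
    ultimately show "ce (cyl_codes W)" by simp
    show "emeasure lam (W i) \<le> ennreal ((1 / 2) ^ i)" for i by (simp add: W_def emeasure_cyl)
  qed
  moreover have "(\<lambda>_. False) \<in> (\<Inter>i. W i)" by (simp add: W_def cyl_def)
  ultimately show False using 0 by (auto simp: MLR_def)
qed

section \<open>The reduction\<close>

definition enumerates :: "(nat \<Rightarrow> nat \<Rightarrow> bool) \<Rightarrow> (nat \<Rightarrow> (nat \<Rightarrow> bool) set) \<Rightarrow> bool" where
  "enumerates Q V \<longleftrightarrow> (\<exists>e. \<forall>p s n. ev p e [s, n] (of_bool (Q s n))) \<and>
    (\<forall>s n. Q s n \<longrightarrow> n \<in> cyl_codes V) \<and>
    (\<forall>n. n \<in> cyl_codes V \<longrightarrow> (\<forall>\<^sub>F s in sequentially. Q s n))"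

lemma mltest_enumerates:
  assumes "mltest V" obtains Q where "enumerates Q V"
proof -
  obtain Q e where "\<And>p s n. ev p e [s, n] (of_bool (Q s n))"
      "\<And>s n. Q s n \<Longrightarrow> n \<in> cyl_codes V"
      "\<And>n. n \<in> cyl_codes V \<Longrightarrow> \<forall>\<^sub>F s in sequentially. Q s n"
    using ce_stages[OF mltestD(2)[OF assms]] by metis
  then show ?thesis using that[of Q] unfolding enumerates_def by blast
qed

lemma decidable_enumeration:
  assumes "enumerates Q V" "computable_on D orc vs F" "computable_on D orc vs G"
  shows "decidable_on D orc vs (\<lambda>c. Q (F c) (G c))"
proof -
  obtain e where e: "\<And>p s n. ev p e [s, n] (of_bool (Q s n))"
    using assms(1) unfolding enumerates_def by blast
  show ?thesis
    by (rule computable_app[where Gs = "[F, G]" and e = e]) (use e assms in auto)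
qed

section \<open>Approximating \<open>rd V X\<close> from prefixes\<close>

definition prefix_code :: "(nat \<Rightarrow> bool) \<Rightarrow> nat \<Rightarrow> nat" where
  "prefix_code X n = code_str (map X [0..<n])"

lemma prefix_code_0: "prefix_code X 0 = 0"
  by (simp add: prefix_code_def)

lemma prefix_code_Suc: "prefix_code X (Suc n) = prefix_code X n + 2 ^ n * (1 + of_bool (X n))"
  unfolding prefix_code_def by (simp add: code_str_snoc)

text \<open>The code of one prefix yields those of all shorter ones, so a program that stores just
  the current code can test them all.\<close>

lemma prefix_code_le:
  assumes "m \<le> n"
  shows "prefix_code X m = 2 ^ m + Suc (prefix_code X n) mod 2 ^ m - 1"
proof -
  have "take m (map X [0..<n]) = map X [0..<m]" using assms by (simp add: take_map)
  then show ?thesis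
    unfolding prefix_code_def using Suc_code_str_take[of m "map X [0..<n]"] assms by simp
qed

text \<open>\<open>hit Q i n (prefix_code X n)\<close> says that within \<open>n\<close> stages a prefix of \<open>X\<close> of length at
  most \<open>n\<close> has been enumerated into the \<open>i\<close>-th component.\<close>

definition hit :: "(nat \<Rightarrow> nat \<Rightarrow> bool) \<Rightarrow> nat \<Rightarrow> nat \<Rightarrow> nat \<Rightarrow> bool" where
  "hit Q i n k \<longleftrightarrow> (\<exists>m\<le>n. Q n (prod_encode (i, 2 ^ m + Suc k mod 2 ^ m - 1)))"

lemma hit_prefix_code:
  "hit Q i n (prefix_code X n) \<longleftrightarrow> (\<exists>m\<le>n. Q n (prod_encode (i, prefix_code X m)))"
  unfolding hit_def by (metis prefix_code_le)

lemma hit_sound: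
  assumes "enumerates Q V" "hit Q i n (prefix_code X n)"
  shows "X \<in> V i"
proof -
  obtain m where "Q n (prod_encode (i, prefix_code X m))"
    using assms(2) unfolding hit_prefix_code by blast
  then have "prod_encode (i, prefix_code X m) \<in> cyl_codes V"
    using assms(1) unfolding enumerates_def by blast
  then have "cyl (map X [0..<m]) \<subseteq> V i" by (simp add: prefix_code_def)
  then show ?thesis using mem_cyl_map by blast
qed

lemma hit_complete:
  assumes "enumerates Q V" "cantor_open (V i)" "X \<in> V i"
  shows "\<forall>\<^sub>F n in sequentially. hit Q i n (prefix_code X n)"
proof -
  obtain m where "cyl (map X [0..<m]) \<subseteq> V i" using cantor_openD_cyl_map[OF assms(2,3)] .
  then have "prod_encode (i, prefix_code X m) \<in> cyl_codes V" by (simp add: prefix_code_def)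
  then have "\<forall>\<^sub>F n in sequentially. Q n (prod_encode (i, prefix_code X m))"
    using assms(1) unfolding enumerates_def by blast
  moreover have "\<forall>\<^sub>F n in sequentially. m \<le> n" by (rule eventually_ge_at_top)
  ultimately show ?thesis by eventually_elim (auto simp: hit_prefix_code)
qed

definition rd_approx :: "(nat \<Rightarrow> nat \<Rightarrow> bool) \<Rightarrow> (nat \<Rightarrow> bool) \<Rightarrow> nat \<Rightarrow> nat" where
  "rd_approx Q X s = (LEAST j. \<not> hit Q j s (prefix_code X s))"

lemma rd_not_mem:
  assumes "mltest V" "X \<in> MLR" shows "X \<notin> V (rd V X)"
proof -
  have "\<exists>i. X \<notin> V i" using assms by (auto simp: MLR_def)
  then show ?thesis unfolding rd_def by (rule LeastI_ex)
qed

text \<open>The finitely many components below \<open>rd V X\<close> contain \<open>X\<close>, hence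
  are all hit from some stage on, whereas the component \<open>rd V X\<close> is never hit, by
  soundness.\<close>

lemma eventually_rd_approx:
  assumes "enumerates Q V" "mltest V" "X \<in> MLR"
  shows "\<forall>\<^sub>F s in sequentially. rd_approx Q X s = rd V X"
proof -
  have "X \<in> V j" if "j < rd V X" for j
    using that not_less_Least unfolding rd_def by blast
  then have "\<forall>\<^sub>F s in sequentially. \<forall>j\<in>{..<rd V X}. hit Q j s (prefix_code X s)"
    using hit_complete[OF assms(1) mltestD(1)[OF assms(2)]]
    by (intro eventually_ball_finite) auto
  then show ?thesis
  proof eventually_elim
    case (elim s)
    show ?case unfolding rd_approx_def
    proof (rule Least_equality)
      show "\<not> hit Q (rd V X) s (prefix_code X s)"
        using hit_sound[OF assms(1)] rd_not_mem[OF assms(2,3)] by blast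
      show "rd V X \<le> j" if "\<not> hit Q j s (prefix_code X s)" for j
        using that elim by (meson lessThan_iff not_le_imp_less)
    qed
  qed
qed

text \<open>The newest guess replaces the unknown \<open>rd V X\<close>; once the guesses have
  settled the two agree. The number \<open>k\<close> stands for the code of the output produced so
  far.\<close>

definition safe :: "(nat \<Rightarrow> nat \<Rightarrow> bool) \<Rightarrow> (nat \<Rightarrow> nat \<Rightarrow> bool) \<Rightarrow> (nat \<Rightarrow> bool) \<Rightarrow> nat \<Rightarrow> nat \<Rightarrow> bool"
  where "safe P Q X n k \<longleftrightarrow> (\<forall>i\<le>n. rd_approx Q X i = rd_approx Q X n \<or> hit P i n k)"

text \<open>Each output bit depends on all earlier ones, so the recursion carries the code of the
  whole output prefix.\<close>

definition guard_code :: "(nat \<Rightarrow> nat \<Rightarrow> bool) \<Rightarrow> (nat \<Rightarrow> nat \<Rightarrow> bool) \<Rightarrow> (nat \<Rightarrow> bool) \<Rightarrow> nat \<Rightarrow> nat"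
  where "guard_code P Q X =
    rec_nat 0 (\<lambda>n k. k + 2 ^ n * (1 + of_bool (X n \<and> safe P Q X n k)))"

text \<open>The sequence \<open>guard P Q X\<close> copies \<open>X\<close>, but pads with zeros as long as some \<open>i\<close> for which
  \<open>rd_approx Q X i\<close> is known to be wrong has not been ruled out as an answer, that is, as
  long as the sequence has not been seen to enter the \<open>i\<close>-th component enumerated by \<open>P\<close>.\<close>

definition guard :: "(nat \<Rightarrow> nat \<Rightarrow> bool) \<Rightarrow> (nat \<Rightarrow> nat \<Rightarrow> bool) \<Rightarrow> (nat \<Rightarrow> bool) \<Rightarrow> nat \<Rightarrow> bool"
  where "guard P Q X n \<longleftrightarrow> X n \<and> safe P Q X n (guard_code P Q X n)"

lemma guard_code_eq: "guard_code P Q X n = prefix_code (guard P Q X) n"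
proof (induction n)
  case (Suc n)
  have "guard_code P Q X (Suc n) = guard_code P Q X n + 2 ^ n * (1 + of_bool (guard P Q X n))"
    by (simp add: guard_code_def guard_def)
  then show ?case using Suc by (simp add: prefix_code_Suc)
qed (simp add: guard_code_def prefix_code_0)

lemma universal_mem:
  assumes "universal_mltest U" "X \<notin> MLR" shows "X \<in> U i"
  using assms unfolding universal_mltest_def MLR_def by blast

lemma guard_props:
  assumes U: "universal_mltest U" and P: "enumerates P U"
    and V: "mltest V" and Q: "enumerates Q V" and X: "X \<in> MLR"
  defines "Y \<equiv> guard P Q X"
  shows "Y \<in> MLR" and "Y \<notin> U i \<Longrightarrow> rd_approx Q X i = rd V X"
proof -
  \<comment> \<open>If \<open>Y\<close> stayed outside \<open>U i\<close>, soundness would exclude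
    every hit at \<open>i\<close>; from the settling stage on, the wrong guess would block all
    further ones in \<open>Y\<close>.\<close>
  have Umem: "Y \<in> U i" if "rd_approx Q X i \<noteq> rd V X" for i
  proof (rule ccontr)
    assume i: "Y \<notin> U i"
    have "\<forall>\<^sub>F n in sequentially. \<not> Y n"
      using eventually_rd_approx[OF Q V X] eventually_ge_at_top[of i]
    proof eventually_elim
      case (elim n)
      then have "\<not> safe P Q X n (guard_code P Q X n)"
        using that hit_sound[OF P] i unfolding safe_def guard_code_eq Y_def by metis
      then show ?case by (simp add: Y_def guard_def)
    qed
    then show False using universal_mem[OF U eventually_False_not_MLR] i by blast
  qed
  then show "Y \<notin> U i \<Longrightarrow> rd_approx Q X i = rd V X" by blast
  \<comment> \<open>Finitely many wrong stages are all hit from some point on; the other stages pass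
    the comparison once the newest guess is correct.\<close>
  let ?F = "{i. rd_approx Q X i \<noteq> rd V X}"
  have "\<forall>\<^sub>F n in sequentially. \<forall>i\<in>?F. hit P i n (prefix_code Y n)"
  proof (intro eventually_ball_finite ballI)
    show "finite ?F"
      using eventually_rd_approx[OF Q V X] by (simp add: eventually_cofinite flip: cofinite_eq_sequentially)
    show "\<forall>\<^sub>F n in sequentially. hit P i n (prefix_code Y n)" if "i \<in> ?F" for i
      using that Umem U mltestD(1) by (intro hit_complete[OF P]) (auto simp: universal_mltest_def)
  qed
  then have "\<forall>\<^sub>F n in sequentially. Y n = X n"
    using eventually_rd_approx[OF Q V X]
  proof eventually_elim
    case (elim n)
    then have "safe P Q X n (guard_code P Q X n)"
      unfolding safe_def guard_code_eq Y_def by auto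
    then show ?case by (simp add: Y_def guard_def)
  qed
  with X show "Y \<in> MLR" by (rule MLR_finite_change)
qed

section \<open>Computability of the construction\<close>

text \<open>Below, \<open>a\<close> is the stride with which the bits of the input \<open>X\<close> occur in the oracle: 1 if the
  oracle is \<open>X\<close> itself, and 2 if it is paired with a second sequence.\<close>

lemma decidable_input_bit:
  assumes "\<And>c m. c \<in> D \<Longrightarrow> orc c (a * m) = of_bool (X c m)" "computable_on D orc vs F"
  shows "decidable_on D orc vs (\<lambda>c. X c (F c))"
proof -
  have "computable_on D orc vs (\<lambda>c. orc c (a * F c))"
    by (intro computable_oracle comp_intros assms)
  then show ?thesis by (rule computable_cong) (simp add: assms)
qed

lemma computable_prefix_code:
  assumes X: "\<And>c m. c \<in> D \<Longrightarrow> orc c (a * m) = of_bool (X c m)" and "computable_on D orc vs F"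
  shows "computable_on D orc vs (\<lambda>c. prefix_code (X c) (F c))"
proof -
  have "computable_on D orc vs
      (\<lambda>c. rec_nat 0 (\<lambda>n k. k + 2 ^ n * (1 + of_bool (X c n))) (F c))"
    by (intro comp_intros assms(2) decidable_input_bit[where a = a and X = "\<lambda>d. X (snd (snd d))"])
      (auto simp: X intro!: computable_var)
  moreover have "rec_nat 0 (\<lambda>n k. k + 2 ^ n * (1 + of_bool (Z n))) m = prefix_code Z m" for Z m
    by (induction m) (simp_all add: prefix_code_0 prefix_code_Suc)
  ultimately show ?thesis by simp
qed

lemma decidable_hit:
  assumes Q: "enumerates Q V" and "computable_on D orc vs I" "computable_on D orc vs N"
    "computable_on D orc vs K"
  shows "decidable_on D orc vs (\<lambda>c. hit Q (I c) (N c) (K c))"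
proof -
  have w: "computable_on (UNIV \<times> D) (\<lambda>d. orc (snd d)) (fst # map (\<lambda>v d. v (snd d)) vs)
      (\<lambda>d. F (snd d))" if "computable_on D orc vs F" for F
    by (rule computable_weaken[OF that, where h = snd]) auto
  show ?thesis
    unfolding hit_def
    by (intro comp_intros decidable_enumeration[OF Q] w assms) (auto intro!: computable_var)
qed

text \<open>Randomness makes the search halt: \<open>X c\<close> lies outside some component, and by
  soundness that component is never hit.\<close>

lemma computable_rd_approx:
  assumes Q: "enumerates Q V" and V: "mltest V" and MLR: "\<And>c. c \<in> D \<Longrightarrow> X c \<in> MLR"
    and X: "\<And>c m. c \<in> D \<Longrightarrow> orc c (a * m) = of_bool (X c m)" and S: "computable_on D orc vs S"
  shows "computable_on D orc vs (\<lambda>c. rd_approx Q (X c) (S c))"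
  unfolding rd_approx_def
proof (rule computable_Least)
  have w: "computable_on (UNIV \<times> D) (\<lambda>d. orc (snd d)) (fst # map (\<lambda>v d. v (snd d)) vs)
      (\<lambda>d. S (snd d))"
    by (rule computable_weaken[OF S, where h = snd]) auto
  show "decidable_on (UNIV \<times> D) (\<lambda>d. orc (snd d)) (fst # map (\<lambda>v d. v (snd d)) vs)
      (\<lambda>d. \<not> hit Q (fst d) (S (snd d)) (prefix_code (X (snd d)) (S (snd d))))"
    by (intro comp_intros decidable_hit[OF Q] w
        computable_prefix_code[where a = a and X = "\<lambda>d. X (snd d)"])
      (auto simp: X intro!: computable_var)
  show "\<exists>j. \<not> hit Q j (S c) (prefix_code (X c) (S c))" if "c \<in> D" for c
    using hit_sound[OF Q] rd_not_mem[OF V MLR[OF that]] by blast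
qed

lemma decidable_safe:
  assumes P: "enumerates P U" and Q: "enumerates Q V" and V: "mltest V"
    and MLR: "\<And>c. c \<in> D \<Longrightarrow> X c \<in> MLR"
    and X: "\<And>c m. c \<in> D \<Longrightarrow> orc c (a * m) = of_bool (X c m)"
    and N: "computable_on D orc vs N" and K: "computable_on D orc vs K"
  shows "decidable_on D orc vs (\<lambda>c. safe P Q (X c) (N c) (K c))"
proof -
  have w: "computable_on (UNIV \<times> D) (\<lambda>d. orc (snd d)) (fst # map (\<lambda>v d. v (snd d)) vs)
      (\<lambda>d. F (snd d))" if "computable_on D orc vs F" for F
    by (rule computable_weaken[OF that, where h = snd]) auto
  show ?thesis
    unfolding safe_def
    by (intro comp_intros decidable_hit[OF P] w[OF N] w[OF K] N
        computable_rd_approx[OF Q V, where a = a and X = "\<lambda>d. X (snd d)"])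
      (auto simp: X intro!: computable_var MLR)
qed

lemma decidable_guard:
  assumes P: "enumerates P U" and Q: "enumerates Q V" and V: "mltest V"
    and MLR: "\<And>c. c \<in> D \<Longrightarrow> X c \<in> MLR"
    and X: "\<And>c m. c \<in> D \<Longrightarrow> orc c (a * m) = of_bool (X c m)"
    and N: "computable_on D orc vs N"
  shows "decidable_on D orc vs (\<lambda>c. guard P Q (X c) (N c))"
proof -
  have "computable_on D orc vs (\<lambda>c. guard_code P Q (X c) (N c))"
    unfolding guard_code_def
    by (intro comp_intros N decidable_input_bit[where a = a and X = "\<lambda>d. X (snd (snd d))"]
        decidable_safe[OF P Q V, where a = a and X = "\<lambda>d. X (snd (snd d))"])
      (auto simp: X intro!: computable_var MLR)
  then show ?thesis
    unfolding guard_def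
    by (intro comp_intros N decidable_input_bit[where a = a and X = X]
        decidable_safe[OF P Q V, where a = a and X = X] X MLR)
qed

section \<open>Representations, realizers and the reductions\<close>

lemma rep_MLR_eq_Some: "rep_MLR p = Some X \<longleftrightarrow> X \<in> MLR \<and> p = (\<lambda>n. of_bool (X n))"
proof
  assume p: "rep_MLR p = Some X"
  then have "\<exists>Z\<in>MLR. p = (\<lambda>n. of_bool (Z n))"
    unfolding rep_MLR_def by (rule contrapos_pp) (simp only: if_False option.distinct not_False_eq_True)
  then obtain Z where Z: "Z \<in> MLR" "p = (\<lambda>n. of_bool (Z n))" by blast
  then have "rep_MLR p = Some (\<lambda>n. p n = 1)" unfolding rep_MLR_def by (intro if_P) blast
  then have "X = (\<lambda>n. p n = 1)" using p by simp
  then have "X = Z" by (simp add: Z(2))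
  then show "X \<in> MLR \<and> p = (\<lambda>n. of_bool (X n))" using Z by blast
next
  assume X: "X \<in> MLR \<and> p = (\<lambda>n. of_bool (X n))"
  then have "rep_MLR p = Some (\<lambda>n. p n = 1)" unfolding rep_MLR_def by (intro if_P) blast
  moreover have "(\<lambda>n. p n = 1) = X" using X by simp
  ultimately show "rep_MLR p = Some X" by simp
qed

lemma of_bool_eq_inject:
  "((\<lambda>i. of_bool (i = n)) :: nat \<Rightarrow> nat) = (\<lambda>i. of_bool (i = m)) \<longleftrightarrow> n = m"
proof
  assume "((\<lambda>i. of_bool (i = n)) :: nat \<Rightarrow> nat) = (\<lambda>i. of_bool (i = m))"
  from fun_cong[OF this, of n] show "n = m" by (cases "n = m") simp_all
qed simp

lemma rep_nat_of_bool: "rep_nat (\<lambda>i. of_bool (i = n)) = Some n"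
  unfolding rep_nat_def of_bool_eq_inject by simp

lemma rep_nat_eq_Some: "rep_nat q = Some n \<longleftrightarrow> q = (\<lambda>i. of_bool (i = n))"
proof
  assume q: "rep_nat q = Some n"
  then have "\<exists>m. q = (\<lambda>i. of_bool (i = m))"
    unfolding rep_nat_def by (rule contrapos_pp) (simp only: if_False option.distinct not_False_eq_True)
  then show "q = (\<lambda>i. of_bool (i = n))" using q rep_nat_of_bool by fastforce
qed (simp only: rep_nat_of_bool)

text \<open>\<open>e1\<close> computes the query \<open>guard P Q X\<close> from \<open>X\<close>.
  \<open>e2\<close> reads the answer \<open>i\<close> as a stage and evaluates the guess for
  \<open>X\<close> there, which is right by \<open>guard_props\<close>.\<close>

lemma RD_le_LAY:
  assumes U: "universal_mltest U" and V: "mltest V"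
  shows "W_le rep_MLR rep_nat (RD V) rep_MLR rep_nat (LAY U)"
proof -
  have mU: "mltest U" using U by (simp add: universal_mltest_def)
  obtain P where P: "enumerates P U" using mltest_enumerates[OF mU] .
  obtain Q where Q: "enumerates Q V" using mltest_enumerates[OF V] .
  have "decidable_on (MLR \<times> UNIV) (\<lambda>c n. of_bool (fst c n)) [snd] (\<lambda>c. guard P Q (fst c) (snd c))"
    by (rule decidable_guard[OF P Q V, where a = 1]) (auto intro!: computable_var)
  then obtain e1 where e1: "\<And>X n. X \<in> MLR \<Longrightarrow>
      ev (\<lambda>n. of_bool (X n)) e1 [n] (of_bool (guard P Q X n))"
    unfolding computable_on_def by auto
  let ?D = "MLR \<times> UNIV :: ((nat \<Rightarrow> bool) \<times> nat \<times> nat) set"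
  let ?orc = "\<lambda>c :: (nat \<Rightarrow> bool) \<times> nat \<times> nat.
    bpair (\<lambda>n. of_bool (fst c n)) (\<lambda>n. of_bool (n = fst (snd c)))"
  let ?vs = "[\<lambda>c. snd (snd c)] :: ((nat \<Rightarrow> bool) \<times> nat \<times> nat \<Rightarrow> nat) list"
  \<comment> \<open>The answer arrives as a characteristic function on the odd positions; the
    position of its only 1 is \<open>i\<close>.\<close>
  have "computable_on ?D ?orc ?vs (\<lambda>c. LEAST i. ?orc c (2 * i + 1) = 1)"
  proof (rule computable_Least)
    show "decidable_on (UNIV \<times> ?D) (\<lambda>d. ?orc (snd d)) (fst # map (\<lambda>v d. v (snd d)) ?vs)
        (\<lambda>d. ?orc (snd d) (2 * fst d + 1) = 1)"
      by (intro decidable_eq computable_oracle[where orc = "\<lambda>d. ?orc (snd d)"] comp_intros)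
        (auto intro!: computable_var)
    show "\<exists>i. ?orc c (2 * i + 1) = 1" for c
      by (rule exI[of _ "fst (snd c)"]) (simp add: bpair_def)
  qed
  then have i: "computable_on ?D ?orc ?vs (\<lambda>c. fst (snd c))"
    by (rule computable_cong) (auto simp: bpair_def intro!: Least_equality)
  \<comment> \<open>The result is again represented by a characteristic function. Pairing puts
    \<open>X\<close> on the even positions, hence stride 2.\<close>
  have "decidable_on ?D ?orc ?vs (\<lambda>c. snd (snd c) = rd_approx Q (fst c) (fst (snd c)))"
    by (intro decidable_eq computable_rd_approx[OF Q V, where a = 2] i)
      (auto simp: bpair_def intro!: computable_var)
  then obtain e2 where e2: "\<And>X i n. X \<in> MLR \<Longrightarrow>
      ev (bpair (\<lambda>n. of_bool (X n)) (\<lambda>n. of_bool (n = i))) e2 [n] (of_bool (n = rd_approx Q X i))"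
    unfolding computable_on_def by auto
  show ?thesis
    unfolding W_le_def
  proof (intro exI allI impI)
    fix \<Gamma> assume \<Gamma>: "realizer rep_MLR rep_nat (LAY U) \<Gamma>"
    show "realizer rep_MLR rep_nat (RD V) (\<lambda>p. case tfun e1 p of None \<Rightarrow> None
      | Some r \<Rightarrow> (case \<Gamma> r of None \<Rightarrow> None | Some q \<Rightarrow> tfun e2 (bpair p q)))"
      unfolding realizer_def
    proof (intro allI impI)
      fix p X assume "rep_MLR p = Some X"
      then have X: "X \<in> MLR" and p: "p = (\<lambda>n. of_bool (X n))" by (auto simp: rep_MLR_eq_Some)
      let ?Y = "guard P Q X"
      let ?r = "\<lambda>n. of_bool (?Y n) :: nat"
      have Y: "?Y \<in> MLR" and Y_rd: "\<And>i. ?Y \<notin> U i \<Longrightarrow> rd_approx Q X i = rd V X"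
        using guard_props[OF U P V Q X] by blast+
      have t1: "tfun e1 p = Some ?r" using e1[OF X] unfolding p by (rule tfun_eqI)
      have "rep_MLR ?r = Some ?Y" using Y by (simp add: rep_MLR_eq_Some)
      moreover have "LAY U ?Y \<noteq> {}" using Y rd_not_mem[OF mU Y] by (auto simp: LAY_def)
      ultimately obtain q i where q: "\<Gamma> ?r = Some q" "rep_nat q = Some i" "i \<in> LAY U ?Y"
        using \<Gamma> unfolding realizer_def by blast
      have i: "rd_approx Q X i = rd V X" using q(3) Y Y_rd by (simp add: LAY_def)
      have "tfun e2 (bpair p q) = Some (\<lambda>n. of_bool (n = rd V X))"
        using e2[OF X, of i] q(2) unfolding p i rep_nat_eq_Some by (intro tfun_eqI) simp
      then show "\<exists>q' y. (case tfun e1 p of None \<Rightarrow> None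
          | Some r \<Rightarrow> (case \<Gamma> r of None \<Rightarrow> None | Some q \<Rightarrow> tfun e2 (bpair p q))) = Some q' \<and>
          rep_nat q' = Some y \<and> y \<in> RD V X"
        using X by (simp add: t1 q(1) rep_nat_eq_Some RD_def)
    qed
  qed
qed

lemma W_le_mono:
  assumes "W_le dX dY f dX' dY' g"
    and f: "\<And>\<Gamma>. realizer dX dY f \<Gamma> \<Longrightarrow> realizer dX dY f' \<Gamma>"
    and g: "\<And>\<Gamma>. realizer dX' dY' g' \<Gamma> \<Longrightarrow> realizer dX' dY' g \<Gamma>"
  shows "W_le dX dY f' dX' dY' g'"
proof -
  obtain e1 e2 where e: "\<And>\<Gamma>. realizer dX' dY' g \<Gamma> \<Longrightarrow>
      realizer dX dY f (\<lambda>p. case tfun e1 p of None \<Rightarrow> None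
        | Some r \<Rightarrow> (case \<Gamma> r of None \<Rightarrow> None | Some q \<Rightarrow> tfun e2 (bpair p q)))"
    using assms(1) unfolding W_le_def by blast
  show ?thesis unfolding W_le_def
    by (intro exI[of _ e1] exI[of _ e2] allI impI) (rule f[OF e[OF g]])
qed

lemma realizer_RD_imp_LAY:
  assumes "mltest V" "realizer dX dY (RD V) \<Gamma>" shows "realizer dX dY (LAY V) \<Gamma>"
proof -
  have "RD V X \<noteq> {}" if "LAY V X \<noteq> {}" for X
    using that by (auto simp: RD_def LAY_def split: if_splits)
  moreover have "RD V X \<subseteq> LAY V X" for X
    by (auto simp: RD_def LAY_def rd_not_mem[OF assms(1)])
  ultimately show ?thesis using assms(2) unfolding realizer_def by (meson in_mono)
qed

theorem theorem5p4:
  fixes U V :: "nat \<Rightarrow> (nat \<Rightarrow> bool) set"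
  assumes "universal_mltest U" and "universal_mltest V"
  shows "W_equiv rep_MLR rep_nat (RD V) rep_MLR rep_nat (LAY U)"
proof -
  have mU: "mltest U" and mV: "mltest V" using assms by (auto simp: universal_mltest_def)
  have "W_le rep_MLR rep_nat (LAY U) rep_MLR rep_nat (RD V)"
    \<comment> \<open>Here the roles of the two tests are exchanged: \<open>RD U\<close> is reduced
      to \<open>LAY V\<close>, and then both sides are replaced.\<close>
    using RD_le_LAY[OF assms(2) mU] realizer_RD_imp_LAY[OF mU] realizer_RD_imp_LAY[OF mV]
    by (rule W_le_mono)
  then show ?thesis using RD_le_LAY[OF assms(1) mV] unfolding W_equiv_def by blast
qed

end
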